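(* Consider the classical central limit operator $T$ with $\chi$ the standard Gaussian distribution (classical case), and the free central limit operator $T$ with $\chi$ the standard Wigner semicircle law (free case). In each case, on the space of measures with all moments finite (measures being identified with their moment sequences), the linearization of $T$ at $\chi$ has eigenvalues $2^{1-n/2}$, $n=1,2,\ldots$. The corresponding eigenfunctions (i.e. the measures whose moment sequences are the eigenvectors for the eigenvalue $2^{1-n/2}$, determined up to a scalar multiple) are absolutely continuous with respect to the Lebesgue measure, with densities: (1) in the classical case, $\frac{d^n}{dx^n}e^{-x^2/2}=e^{-x^2/2}H_n(x)$, where $H_n$ is a multiple of the $n$-th Hermite polynomial; (2) in the free case, scalar multiples of $\mathbf{1}_{[-2,2]}(t)\,\frac{1}{\sqrt{4-t^2}}\,T_n(t/2)$, where $T_n$ is the $n$-th Chebyshev polynomial of the first kind.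
   Context: Central limit operators. For $r>0$ and a measure $\mu$ on $\mathbb{R}$, $\mu\circ S_r$ is the dilation $d(\mu\circ S_r)(x)=d\mu(r^{-1}x)$. The classical central limit operator is $T(\mu)=(\mu\ast\mu)\circ S_{1/\sqrt2}$, with $\ast$ the convolution. The free central limit operator is $T(\mu)=(\mu\boxplus\mu)\circ S_{1/\sqrt2}$, with $\boxplus$ the additive free convolution (the distribution of the sum of two freely independent random variables with the given distributions). The normal distribution $\chi$ denotes the standard Gaussian (density $\frac{1}{\sqrt{2\pi}}e^{-x^2/2}$) in the classical case and the standard Wigner semicircle law (density $\frac{1}{2\pi}\sqrt{4-t^2}$ on $[-2,2]$) in the free case; it is a fixed point of the corresponding $T$. Identification with moment sequences. The $n$-th moment of $\mu$ is $m_n^\mu=\int x^n\,d\mu(x)$. Measures with all moments finite are identified with their moment sequences, disregarding non-uniqueness. Let $\mathcal{M}$ be the topological vector space of all real sequences $\mathbf{m}=\{m_i\}_{i=1}^\infty$ with the topology of entrywise convergence. The eigenfunctions are in general signed measures with total mass $0$, represented in $\mathcal{M}$ by their moments of orders $i\ge1$. Cumulants. The bijection $\mathcal{R}:\mathcal{M}\to\mathcal{M}$, $\{m_i\}\mapsto\{c_i\}$, is defined implicitly as follows, where $|B|$ denotes the number of elements of a class $B$. Free case: $m_k=\sum_{\pi=\{B_1,\ldots,B_n\}\in\mathcal{P}_{nc}(k)}\prod_{j=1}^n c_{|B_j|}$, where $\mathcal{P}_{nc}(k)$ is the set of noncrossing partitions of $\{1,\ldots,k\}$. Classical case: $m_k=\sum_{\pi=\{B_1,\ldots,B_n\}\in\mathcal{P}(k)}\prod_{j=1}^n(|B_j|-1)!\,c_{|B_j|}$,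 where $\mathcal{P}(k)$ is the set of all partitions of $\{1,\ldots,k\}$. For probability measures $\mu$ with all moments finite, the cumulants satisfy $c_k^{T\mu}=2^{1-k/2}c_k^\mu$. Accordingly, on $\mathcal{M}$ the operator $T$ is represented by $\mathcal{T}=\mathcal{R}^{-1}\circ\mathcal{T}^{\mathcal{R}}\circ\mathcal{R}$, where $(\mathcal{T}^{\mathcal{R}}(\mathbf{c}))_k=2^{1-k/2}c_k$. Linearization. The linearization of a map $A$ at a point $x$ is its G\^ateaux derivative $(D_xA)(y)=\lim_{\epsilon\to0}\frac{A(x+\epsilon y)-A(x)}{\epsilon}$. The linearization of $T$ at $\chi$ means $D_{\mathbf{m}^\chi}\mathcal{T}$ acting on $\mathcal{M}$, where $\mathbf{m}^\chi$ is the moment sequence of $\chi$. Polynomials. $H_n(x)=e^{x^2/2}\frac{d^n}{dx^n}e^{-x^2/2}$; $T_n(\cos\theta)=\cos(n\theta)$. *)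

theory Defs
  imports "HOL-Probability.Probability" "HOL-Computational_Algebra.Polynomial"
begin

section \<open>Sequences, moments and cumulants\<close>

text \<open>
  The space of real sequences indexed from 1 is the type \<^typ>\<open>nat \<Rightarrow> real\<close> with an index shift:
  \<open>s i\<close> is the entry of order \<open>i + 1\<close>, so the entry of order \<open>k \<ge> 1\<close> of \<open>s\<close> is \<open>s (k - 1)\<close>.
  The topology of entrywise convergence is the product topology carried by this type.
\<close>

type_synonym seq = "nat \<Rightarrow> real"

definition noncrossing :: "nat set set \<Rightarrow> bool" where
  "noncrossing \<pi> \<longleftrightarrow>
     (\<forall>B\<in>\<pi>. \<forall>C\<in>\<pi>. \<forall>p q r s.
        p < q \<and> q < r \<and> r < s \<and> p \<in> B \<and> r \<in> B \<and> q \<in> C \<and> s \<in> C \<longrightarrow> B = C)"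

text \<open>
  The moments-from-cumulants maps, i.e. the inverse of the cumulant map. The entry at index
  \<open>i\<close> is the moment of order \<open>Suc i\<close>. In the classical case the cumulants carry the normalisation
  in which \<open>(k - 1)!\<close> times the cumulant of order \<open>k\<close> is the usual cumulant.
\<close>

definition classical_moments :: "seq \<Rightarrow> seq" where
  "classical_moments c = (\<lambda>i.
     \<Sum>\<pi> | partition_on {1..Suc i} \<pi>. \<Prod>B\<in>\<pi>. fact (card B - 1) * c (card B - 1))"

definition free_moments :: "seq \<Rightarrow> seq" where
  "free_moments c = (\<lambda>i.
     \<Sum>\<pi> | partition_on {1..Suc i} \<pi> \<and> noncrossing \<pi>. \<Prod>B\<in>\<pi>. c (card B - 1))"

definition classical_cumulants :: "seq \<Rightarrow> seq" where
  "classical_cumulants = inv classical_moments"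

definition free_cumulants :: "seq \<Rightarrow> seq" where
  "free_cumulants = inv free_moments"


section \<open>The central limit operators and their linearization\<close>

text \<open>The \<open>k\<close>-th cumulant is multiplied by \<open>2 powr (1 - k / 2)\<close>, where \<open>k = Suc i\<close>.\<close>

definition cumulant_scaling :: "seq \<Rightarrow> seq" where
  "cumulant_scaling c = (\<lambda>i. 2 powr (1 - real (Suc i) / 2) * c i)"

definition classical_clt :: "seq \<Rightarrow> seq" where
  "classical_clt = classical_moments \<circ> cumulant_scaling \<circ> classical_cumulants"

definition free_clt :: "seq \<Rightarrow> seq" where
  "free_clt = free_moments \<circ> cumulant_scaling \<circ> free_cumulants"

definition has_gateaux_derivative :: "(seq \<Rightarrow> seq) \<Rightarrow> seq \<Rightarrow> seq \<Rightarrow> seq \<Rightarrow> bool" where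
  "has_gateaux_derivative A x y d \<longleftrightarrow>
     ((\<lambda>\<epsilon> i. (A (\<lambda>j. x j + \<epsilon> * y j) i - A x i) / \<epsilon>) \<longlongrightarrow> d) (at (0::real))"

definition gateaux_derivative :: "(seq \<Rightarrow> seq) \<Rightarrow> seq \<Rightarrow> seq \<Rightarrow> seq" where
  "gateaux_derivative A x y = (THE d. has_gateaux_derivative A x y d)"

definition eigenvector :: "(seq \<Rightarrow> seq) \<Rightarrow> real \<Rightarrow> seq \<Rightarrow> bool" where
  "eigenvector L l y \<longleftrightarrow> y \<noteq> (\<lambda>i. 0) \<and> L y = (\<lambda>i. l * y i)"


section \<open>Measures and signed measures\<close>

definition moment :: "real measure \<Rightarrow> nat \<Rightarrow> real" where
  "moment M k = (\<integral>x. x ^ k \<partial>M)"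

definition moment_seq :: "real measure \<Rightarrow> seq" where
  "moment_seq M = (\<lambda>i. moment M (Suc i))"

definition gaussian :: "real measure" where
  "gaussian = density lborel (\<lambda>x. ennreal (std_normal_density x))"

definition semicircle :: "real measure" where
  "semicircle = density lborel
     (\<lambda>t. ennreal (indicator {-2..2} t * (1 / (2 * pi) * sqrt (4 - t\<^sup>2))))"

text \<open>A pair \<open>(P, N)\<close> of Borel measures represents the signed measure \<open>P - N\<close>.\<close>

type_synonym signed_measure = "real measure \<times> real measure"

definition finite_moments :: "signed_measure \<Rightarrow> bool" where
  "finite_moments \<nu> \<longleftrightarrow>
     (\<forall>M\<in>{fst \<nu>, snd \<nu>}. sets M = sets borel \<and> finite_measure M \<and>
        (\<forall>k. integrable M (\<lambda>x. x ^ k)))"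

definition total_mass :: "signed_measure \<Rightarrow> real" where
  "total_mass \<nu> = measure (fst \<nu>) UNIV - measure (snd \<nu>) UNIV"

definition signed_moment_seq :: "signed_measure \<Rightarrow> seq" where
  "signed_moment_seq \<nu> = (\<lambda>i. moment (fst \<nu>) (Suc i) - moment (snd \<nu>) (Suc i))"

text \<open>
  The signed measure with Lebesgue density \<open>f\<close>, by its Jordan decomposition; \<^const>\<open>ennreal\<close>
  maps negative reals to 0, so the two densities are the positive and the negative part of \<open>f\<close>.
\<close>

definition signed_density :: "(real \<Rightarrow> real) \<Rightarrow> signed_measure" where
  "signed_density f =
     (density lborel (\<lambda>x. ennreal (f x)), density lborel (\<lambda>x. ennreal (- f x)))"

text \<open>
  The eigenfunctions of \<open>L\<close> for the eigenvalue \<open>l\<close> are the signed measures with density a nonzero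
  scalar multiple of \<open>f\<close>: each of them is a measure of total mass 0 with all moments finite
  whose moment sequence is an eigenvector, and every eigenvector is such a moment sequence.
\<close>

definition eigenfunctions_have_density ::
    "(seq \<Rightarrow> seq) \<Rightarrow> real \<Rightarrow> (real \<Rightarrow> real) \<Rightarrow> bool" where
  "eigenfunctions_have_density L l f \<longleftrightarrow>
     f \<in> borel_measurable borel \<and>
     (\<forall>a. a \<noteq> 0 \<longrightarrow>
        finite_moments (signed_density (\<lambda>x. a * f x)) \<and>
        total_mass (signed_density (\<lambda>x. a * f x)) = 0) \<and>
     {y. eigenvector L l y} =
       {signed_moment_seq (signed_density (\<lambda>x. a * f x)) |a. a \<noteq> 0}"


section \<open>Hermite and Chebyshev polynomials\<close>

definition hermite_fun :: "nat \<Rightarrow> real \<Rightarrow> real" where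
  "hermite_fun n x = exp (x\<^sup>2 / 2) * (deriv ^^ n) (\<lambda>u. exp (- u\<^sup>2 / 2)) x"

text \<open>The Hermite polynomials orthogonal for the weight \<open>exp (- x\<^sup>2 / 2)\<close>, normalised to be monic.\<close>

fun hermite_poly :: "nat \<Rightarrow> real poly" where
  "hermite_poly 0 = 1"
| "hermite_poly (Suc 0) = [:0, 1:]"
| "hermite_poly (Suc (Suc n)) =
     [:0, 1:] * hermite_poly (Suc n) - smult (real (Suc n)) (hermite_poly n)"

fun cheb_poly :: "nat \<Rightarrow> real poly" where
  "cheb_poly 0 = 1"
| "cheb_poly (Suc 0) = [:0, 1:]"
| "cheb_poly (Suc (Suc n)) = [:0, 2:] * cheb_poly (Suc n) - cheb_poly n"

lemma cheb_poly_cos: "poly (cheb_poly n) (cos \<theta>) = cos (real n * \<theta>)"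
proof (induction n rule: cheb_poly.induct)
  case (3 n)
  have "cos (real (Suc (Suc n)) * \<theta>) + cos (real n * \<theta>)
      = cos (real (Suc n) * \<theta> + \<theta>) + cos (real (Suc n) * \<theta> - \<theta>)"
    by (simp add: algebra_simps)
  also have "\<dots> = 2 * cos \<theta> * cos (real (Suc n) * \<theta>)"
    by (simp only: cos_add cos_diff) simp
  finally show ?case using 3 by simp
qed auto


section \<open>Well-definedness\<close>

lemma bij_triangular:
  fixes F :: "seq \<Rightarrow> seq" and G :: "seq \<Rightarrow> nat \<Rightarrow> real" and a :: "nat \<Rightarrow> real"
  assumes F: "\<And>c i. F c i = a i * c i + G c i"
    and a: "\<And>i. a i \<noteq> 0"
    and G: "\<And>c d i. (\<And>j. j < i \<Longrightarrow> c j = d j) \<Longrightarrow> G c i = G d i"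
  shows "bij F"
proof (rule bijI)
  show "inj F"
  proof (rule injI)
    fix c d assume eq: "F c = F d"
    have "c i = d i" for i
    proof (induction i rule: less_induct)
      case (less i)
      have "a i * c i + G c i = a i * d i + G d i" using eq F by metis
      then show ?case using G[of i c d] less a[of i] by simp
    qed
    then show "c = d" by blast
  qed
  show "surj F"
  proof (rule surjI)
    fix m :: seq
    define R where "R m = wfrec less_than (\<lambda>c i. (m i - G c i) / a i)" for m
    have "R m i = (m i - G (R m) i) / a i" for i
    proof -
      have "R m i = (m i - G (cut (R m) less_than i) i) / a i"
        unfolding R_def by (subst wfrec) auto
      also have "G (cut (R m) less_than i) i = G (R m) i"
        by (rule G) (simp add: cut_def)
      finally show ?thesis .
    qed
    then have "F (R m) i = m i" for i using F[of "R m" i] a[of i] by simp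
    then show "F (R m) = m" by blast
  qed
qed

lemma bij_partition_sum:
  fixes w :: "nat \<Rightarrow> real"
  assumes w: "\<And>k. w k \<noteq> 0" and Q: "\<And>i. Q {{1..Suc i}}"
  shows "bij (\<lambda>c i. \<Sum>\<pi> | partition_on {1..Suc i} \<pi> \<and> Q \<pi>. \<Prod>B\<in>\<pi>. w (card B - 1) * c (card B - 1))"
    (is "bij ?F")
proof (rule bij_triangular[where a = w])
  let ?P = "\<lambda>i. {\<pi>. partition_on {1..Suc i} \<pi> \<and> Q \<pi>}"
  let ?G = "\<lambda>c i. \<Sum>\<pi> \<in> ?P i - {{{1..Suc i}}}. \<Prod>B\<in>\<pi>. w (card B - 1) * c (card B - 1)"
  show "?F c i = w i * c i + ?G c i" for c i
  proof -
    have fin: "finite (?P i)"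
      by (rule finite_subset[OF _ finitely_many_partition_on[of "{1..Suc i}"]]) auto
    have mem: "{{1..Suc i}} \<in> ?P i"
      using Q by (simp add: partition_on_space)
    show ?thesis
      by (subst sum.remove[OF fin mem]) simp
  qed
  show "?G c i = ?G d i" if eq: "\<And>j. j < i \<Longrightarrow> c j = d j" for c d i
  proof (intro sum.cong prod.cong refl)
    fix \<pi> B assume \<pi>: "\<pi> \<in> ?P i - {{{1..Suc i}}}" and B: "B \<in> \<pi>"
    have part: "partition_on {1..Suc i} \<pi>" and ne: "\<pi> \<noteq> {{1..Suc i}}" using \<pi> by auto
    have sub: "B \<subseteq> {1..Suc i}" using part B by (auto simp: partition_on_def)
    have "B \<noteq> {1..Suc i}"
    proof
      assume eqB: "B = {1..Suc i}"
      have "C = B" if "C \<in> \<pi>" for C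
      proof (rule ccontr)
        assume "C \<noteq> B"
        then have "C \<inter> B = {}" using part B that by (auto simp: partition_on_def disjoint_def)
        moreover have "C \<subseteq> B" using part that eqB by (auto simp: partition_on_def)
        moreover have "C \<noteq> {}" using part that by (auto simp: partition_on_def)
        ultimately show False by auto
      qed
      then have "\<pi> = {B}" using B by blast
      then show False using ne eqB by metis
    qed
    with sub have "card B < card {1..Suc i}" by (intro psubset_card_mono) auto
    moreover have "card B > 0"
      using part B sub by (metis card_gt_0_iff finite_atLeastAtMost finite_subset partition_onD3)
    ultimately have "card B - 1 < i" by simp
    then show "w (card B - 1) * c (card B - 1) = w (card B - 1) * d (card B - 1)" using eq by simp
  qed
qed (use w in auto)

lemma bij_classical_moments: "bij classical_moments"
  using bij_partition_sum[where w = fact and Q = "\<lambda>_. True"]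
  by (simp add: classical_moments_def[abs_def])

lemma bij_free_moments: "bij free_moments"
  using bij_partition_sum[where w = "\<lambda>_. 1" and Q = noncrossing]
  by (simp add: free_moments_def[abs_def] noncrossing_def)

lemma gateaux_derivative_eq:
  assumes "has_gateaux_derivative A x y d"
  shows "gateaux_derivative A x y = d"
  unfolding gateaux_derivative_def
proof (rule the_equality[where P = "has_gateaux_derivative A x y", OF assms])
  have coord: "((\<lambda>\<epsilon>. (A (\<lambda>j. x j + \<epsilon> * y j) i - A x i) / \<epsilon>) \<longlongrightarrow> e i) (at 0)"
    if "has_gateaux_derivative A x y e" for e i
  proof -
    have "isCont (\<lambda>s::seq. s i) e"
      by (metis continuous_on_product_coordinates continuous_on_eq_continuous_at open_UNIV UNIV_I)
    from isCont_tendsto_compose[OF this that[unfolded has_gateaux_derivative_def]]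
    show ?thesis .
  qed
  fix e assume "has_gateaux_derivative A x y e"
  then have "e i = d i" for i
    using tendsto_unique[OF _ coord coord] assms by (metis trivial_limit_at)
  then show "e = d" by blast
qed

end

theory Submission
  imports Defs "HOL-Computational_Algebra.Formal_Power_Series"
begin

text \<open>
  In both cases the moments satisfy a triangular recursion
  \<open>m\<^sub>k = \<Sum>\<^bsub>j \<le> k\<^esub> c\<^sub>j a\<^sub>k\<^sub>j(m)\<close>, where \<open>a\<^sub>k\<^sub>k\<close> is a nonzero constant and \<open>a\<^sub>k\<^sub>j(m)\<close> depends only on
  entries of \<open>m\<close> before \<open>k\<close>: classically by splitting off the block of one chosen point, in the free
  case by splitting off the block of the first point. Hence the cumulant map can be
  differentiated one coordinate at a time, and at \<open>m\<^sup>\<chi>\<close> the linearization of the central limit operator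
  is conjugate to the diagonal scaling of cumulants by the derivative of the moment map. The
  eigenvector for \<open>n\<close> is the derivative \<open>v\<^sub>n\<close> of the moment map in the direction of the \<open>n\<close>-th cumulant.
  As the only nonzero cumulant of \<open>\<chi>\<close> is the second one, differentiating the recursion gives a
  short linear recursion for \<open>v\<^sub>n\<close>. The moments of the stated densities satisfy the same recursion,
  by the three-term recurrences of the Hermite and Chebyshev polynomials.
\<close>

unbundle no vec_syntax
unbundle fps_syntax

section \<open>Moment-cumulant recursion over all set partitions\<close>

definition partition_weight :: "(nat \<Rightarrow> real) \<Rightarrow> 'a set set \<Rightarrow> real" where
  "partition_weight u \<pi> = (\<Prod>B\<in>\<pi>. u (card B))"

lemma finite_partitions: "finite A \<Longrightarrow> finite {\<pi>. partition_on A \<pi> \<and> Q \<pi>}"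
  by (rule finite_subset[OF _ finitely_many_partition_on[of A]]) auto

lemma block_unique: "partition_on A \<pi> \<Longrightarrow> B \<in> \<pi> \<Longrightarrow> C \<in> \<pi> \<Longrightarrow> x \<in> B \<Longrightarrow> x \<in> C \<Longrightarrow> B = C"
  by (auto simp: partition_on_def disjoint_def)

text \<open>Once the block of \<open>x\<close> is fixed as \<open>insert x B\<close>, the other
  blocks form an arbitrary partition of the complement. The conjunct
  \<open>insert x B \<notin> \<rho>\<close> makes \<open>\<rho>\<close> recoverable from the full
  partition.\<close>

lemma partition_on_insert_block:
  assumes "x \<notin> A" "B \<subseteq> A"
  shows "partition_on (insert x A) (insert (insert x B) \<rho>) \<and> insert x B \<notin> \<rho> \<longleftrightarrow> partition_on (A - B) \<rho>"
    (is "?l \<longleftrightarrow> ?r")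
proof
  have eq: "insert x A - insert x B = A - B" using assms by auto
  show ?r if ?l
  proof -
    from that have p: "partition_on (insert x A) (insert (insert x B) \<rho>)" and n: "insert x B \<notin> \<rho>" by auto
    have "disjnt (insert x B) (\<Union>\<rho>)"
      using p n unfolding disjnt_iff by (metis UnionE block_unique insertCI)
    from partition_on_insert[OF this, of "insert x A"] p eq show ?r by simp
  qed
  show ?l if ?r
  proof -
    have d: "disjnt (insert x B) (\<Union>\<rho>)"
      using that assms by (auto simp: partition_on_def disjnt_iff)
    then have "insert x B \<notin> \<rho>" by (auto simp: disjnt_iff)
    then show ?l using partition_on_insert[OF d, of "insert x A"] that eq assms by auto
  qed
qed

text \<open>Partitions are sorted by the block of \<open>x\<close>. Both moment recursions start
  here: \<open>Q\<close> is trivial in the classical case and \<open>noncrossing\<close> in the free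
  case.\<close>

lemma sum_partitions_insert:
  assumes fin: "finite A" and x: "x \<notin> A"
  shows "(\<Sum>\<pi> | partition_on (insert x A) \<pi> \<and> Q \<pi>. partition_weight u \<pi>) =
    (\<Sum>B\<in>Pow A. u (Suc (card B)) *
       (\<Sum>\<rho> | partition_on (A - B) \<rho> \<and> Q (insert (insert x B) \<rho>). partition_weight u \<rho>))"
proof -
  define R where "R B = {\<rho>. partition_on (A - B) \<rho> \<and> Q (insert (insert x B) \<rho>)}" for B
  \<comment> \<open>As \<open>x\<close> lies in exactly one block, this is a union over a singleton
    and equals the block of \<open>x\<close>.\<close>
  define bl where "bl \<pi> = \<Union>{D \<in> \<pi>. x \<in> D}" for \<pi> :: "'a set set"
  have bl: "bl \<pi> = D" if "partition_on (insert x A) \<pi>" "D \<in> \<pi>" "x \<in> D" for \<pi> D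
  proof -
    have "{D \<in> \<pi>. x \<in> D} = {D}" using that block_unique[OF that(1)] by blast
    then show ?thesis by (simp add: bl_def)
  qed
  have "(\<Sum>B\<in>Pow A. u (Suc (card B)) * sum (partition_weight u) (R B)) =
      (\<Sum>(B, \<rho>)\<in>Sigma (Pow A) R. u (Suc (card B)) * partition_weight u \<rho>)"
    unfolding sum_distrib_left R_def using fin by (intro sum.Sigma) (auto intro!: finite_partitions)
  also have "\<dots> = (\<Sum>\<pi> | partition_on (insert x A) \<pi> \<and> Q \<pi>. partition_weight u \<pi>)"
  proof (rule sum.reindex_bij_witness[where j = "\<lambda>(B, \<rho>). insert (insert x B) \<rho>"
        and i = "\<lambda>\<pi>. (bl \<pi> - {x}, \<pi> - {bl \<pi>})"])
    fix a assume a: "a \<in> Sigma (Pow A) R"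
    obtain B \<rho> where [simp]: "a = (B, \<rho>)" by (cases a)
    from a have B: "B \<subseteq> A" and \<rho>: "\<rho> \<in> R B" by auto
    have p: "partition_on (insert x A) (insert (insert x B) \<rho>)" and n: "insert x B \<notin> \<rho>"
      using partition_on_insert_block[OF x B] \<rho> by (auto simp: R_def)
    have b: "bl (insert (insert x B) \<rho>) = insert x B" by (rule bl[OF p]) auto
    have [simp]: "x \<notin> B" using x B by auto
    have fB: "finite B" and fr: "finite \<rho>"
      using B fin finite_subset \<rho> by (auto simp: R_def intro: finite_elements[of "A - B"])
    show "(case case a of (B, \<rho>) \<Rightarrow> insert (insert x B) \<rho> of \<pi> \<Rightarrow> (bl \<pi> - {x}, \<pi> - {bl \<pi>})) = a"
      using b n by simp
    show "(case a of (B, \<rho>) \<Rightarrow> insert (insert x B) \<rho>) \<in> {\<pi>. partition_on (insert x A) \<pi> \<and> Q \<pi>}"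
      using p \<rho> by (auto simp: R_def)
    show "partition_weight u (case a of (B, \<rho>) \<Rightarrow> insert (insert x B) \<rho>) =
        (case a of (B, \<rho>) \<Rightarrow> u (Suc (card B)) * partition_weight u \<rho>)"
      using fB fr n by (simp add: partition_weight_def)
  next
    fix \<pi> assume "\<pi> \<in> {\<pi>. partition_on (insert x A) \<pi> \<and> Q \<pi>}"
    then have p: "partition_on (insert x A) \<pi>" and q: "Q \<pi>" by auto
    obtain D where D: "D \<in> \<pi>" "x \<in> D" using p by (auto simp: partition_on_def)
    have b: "bl \<pi> = D" by (rule bl[OF p D])
    have i: "insert x (bl \<pi> - {x}) = D" "insert D (\<pi> - {D}) = \<pi>" using D b by auto
    then show "(case (bl \<pi> - {x}, \<pi> - {bl \<pi>}) of (B, \<rho>) \<Rightarrow> insert (insert x B) \<rho>) = \<pi>"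
      using b by simp
    have sub: "D - {x} \<subseteq> A" using p D by (auto simp: partition_on_def)
    have "partition_on (A - (D - {x})) (\<pi> - {D})"
      unfolding partition_on_insert_block[OF x sub, symmetric] using p D by (simp add: insert_absorb)
    then show "(bl \<pi> - {x}, \<pi> - {bl \<pi>}) \<in> Sigma (Pow A) R"
      unfolding R_def using i b q sub by simp
  qed
  finally show ?thesis by (simp add: R_def)
qed

definition set_partition_sum :: "(nat \<Rightarrow> real) \<Rightarrow> 'a set \<Rightarrow> real" where
  "set_partition_sum u A = (\<Sum>\<pi> | partition_on A \<pi>. partition_weight u \<pi>)"

lemma sum_Pow_card:
  fixes h :: "nat \<Rightarrow> real"
  assumes "finite A"
  shows "(\<Sum>B\<in>Pow A. h (card B)) = (\<Sum>j\<le>card A. real (card A choose j) * h j)"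
proof -
  have "(\<Sum>B\<in>Pow A. h (card B)) = (\<Sum>j\<le>card A. \<Sum>B | B \<in> Pow A \<and> card B = j. h (card B))"
    using assms by (intro sum.group[symmetric]) (auto intro: card_mono)
  also have "\<dots> = (\<Sum>j\<le>card A. real (card A choose j) * h j)"
    using n_subsets[OF assms] by (intro sum.cong refl) simp
  finally show ?thesis .
qed

lemma set_partition_sum_insert:
  assumes "finite A" "x \<notin> A"
  shows "set_partition_sum u (insert x A) =
    (\<Sum>B\<in>Pow A. u (Suc (card B)) * set_partition_sum u (A - B))"
  using sum_partitions_insert[OF assms, where Q = "\<lambda>_. True"] by (simp add: set_partition_sum_def)

lemma set_partition_sum_insert_card:
  assumes "finite A" "x \<notin> A"
    and IH: "\<And>C. C \<subseteq> A \<Longrightarrow> set_partition_sum u C = s (card C)"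
  shows "set_partition_sum u (insert x A) =
    (\<Sum>j\<le>card A. real (card A choose j) * (u (Suc j) * s (card A - j)))"
proof -
  have "set_partition_sum u (insert x A) =
      (\<Sum>B\<in>Pow A. u (Suc (card B)) * s (card A - card B))"
    unfolding set_partition_sum_insert[OF assms(1,2)] using assms(1)
    by (intro sum.cong refl) (auto simp: IH card_Diff_subset finite_subset)
  then show ?thesis
    using sum_Pow_card[OF assms(1), where h = "\<lambda>j. u (Suc j) * s (card A - j)"] by simp
qed

text \<open>Invariance under relabelling is obtained by induction on the cardinality: splitting off
  a point expresses both sides by the same formula in the sums over smaller sets.\<close>

lemma set_partition_sum_card:
  fixes A :: "nat set"
  assumes "finite A"
  shows "set_partition_sum u A = set_partition_sum u {..<card A}"
  using assms
proof (induction "card A" arbitrary: A rule: less_induct)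
  case less
  define s where "s n = set_partition_sum u {..<n::nat}" for n
  show ?case
  proof (cases "A = {}")
    case False
    then obtain x B where A: "A = insert x B" "x \<notin> B" by (metis Set.set_insert ex_in_conv)
    have IH: "set_partition_sum u C = s (card C)" if "finite C" "card C < card A" for C :: "nat set"
      using less.hyps[OF that(2,1)] by (simp add: s_def)
    have fB: "finite B" using less.prems A by simp
    \<comment> \<open>The auxiliary \<open>D\<close> lets one fact serve both for \<open>B\<close>
      and for \<open>{..<card B}\<close>.\<close>
    have IH': "set_partition_sum u C = s (card C)"
      if "C \<subseteq> D" "finite D" "card D = card B" for C D :: "nat set"
    proof (rule IH)
      show "finite C" using that finite_subset by blast
      have "card C \<le> card D" using that by (intro card_mono)
      then show "card C < card A" using that A fB by simp
    qed
    have cA: "card A = Suc (card B)" using A fB by simp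
    have "set_partition_sum u (insert x B) = set_partition_sum u (insert (card B) {..<card B})"
      by (subst set_partition_sum_insert_card[where s = s, OF fB A(2) IH'[OF _ fB refl]], assumption,
          subst set_partition_sum_insert_card[where s = s, OF _ _ IH'[OF _ finite_lessThan card_lessThan]])
        simp_all
    then show ?thesis using A(1) cA lessThan_Suc by metis
  qed auto
qed

text \<open>The largest point \<open>n\<close> is split off; the binomial coefficient counts the
  choices of the \<open>j\<close> other members of its block.\<close>

lemma set_partition_sum_Suc:
  "set_partition_sum u {..<Suc n} =
    (\<Sum>j\<le>n. real (n choose j) * (u (Suc j) * set_partition_sum u {..<n - j}))"
proof -
  have "set_partition_sum u C = set_partition_sum u {..<card C}" if "C \<subseteq> {..<n}" for C
    using that by (intro set_partition_sum_card) (auto intro: finite_subset)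
  from set_partition_sum_insert_card[OF finite_lessThan _ this, of n]
  show ?thesis by (simp add: lessThan_Suc)
qed

text \<open>Undoes the index shift of \<^typ>\<open>seq\<close>: entry \<open>k\<close> has order \<open>k\<close>, with total mass 1 at order 0.\<close>

definition with_unit :: "seq \<Rightarrow> seq" where
  "with_unit m k = (case k of 0 \<Rightarrow> 1 | Suc i \<Rightarrow> m i)"

lemma with_unit_simps [simp]: "with_unit m 0 = 1" "with_unit m (Suc i) = m i"
  by (auto simp: with_unit_def)

lemma with_unit_classical_moments:
  "with_unit (classical_moments c) n =
     set_partition_sum (\<lambda>k. fact (k - 1) * c (k - 1)) {..<n}"
proof (cases n)
  case 0
  then show ?thesis
    by (simp add: set_partition_sum_def partition_on_empty partition_weight_def)
next
  case (Suc i)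
  show ?thesis
    using set_partition_sum_card[of "{1..Suc i}" "\<lambda>k. fact (k - 1) * c (k - 1)"] Suc
    by (simp add: classical_moments_def set_partition_sum_def partition_weight_def)
qed

text \<open>A block of size \<open>Suc j\<close> has weight \<open>fact j * c j\<close>. For
  \<open>j = k\<close> the factor of \<open>c k\<close> is \<open>fact k\<close>, independent of the
  moments, which makes the recursion triangular.\<close>

lemma classical_moments_rec:
  "classical_moments c k =
     (\<Sum>j\<le>k. c j * (fact j * real (k choose j) * with_unit (classical_moments c) (k - j)))"
proof -
  have "classical_moments c k = with_unit (classical_moments c) (Suc k)" by simp
  then show ?thesis
    unfolding with_unit_classical_moments set_partition_sum_Suc by (simp add: mult_ac)
qed

section \<open>Moment-cumulant recursion over noncrossing partitions\<close>

text \<open>Both endpoints are kept because splitting off the first block leaves gaps at various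
  positions; dependence on the length alone is the content of
  \<open>nc_sum_translation\<close>.\<close>

definition nc_sum :: "(nat \<Rightarrow> real) \<Rightarrow> nat \<Rightarrow> nat \<Rightarrow> real" where
  "nc_sum u a b = (\<Sum>\<pi> | partition_on {a..<b} \<pi> \<and> noncrossing \<pi>. partition_weight u \<pi>)"

definition nc_sum_block :: "(nat \<Rightarrow> real) \<Rightarrow> nat \<Rightarrow> nat \<Rightarrow> nat set \<Rightarrow> real" where
  "nc_sum_block u a b B =
     (\<Sum>\<rho> | partition_on ({a..<b} - B) \<rho> \<and> noncrossing (insert B \<rho>). partition_weight u \<rho>)"

text \<open>The block of the first point \<open>a\<close> carries no weight here and has \<open>s\<close> further elements.\<close>

definition first_block_sum :: "(nat \<Rightarrow> real) \<Rightarrow> nat \<Rightarrow> nat \<Rightarrow> nat \<Rightarrow> real" where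
  "first_block_sum u a b s = (\<Sum>B | B \<subseteq> {Suc a..<b} \<and> card B = s. nc_sum_block u a b (insert a B))"

lemma noncrossingD:
  assumes "noncrossing \<pi>" "B \<in> \<pi>" "C \<in> \<pi>" "p \<in> B" "r \<in> B" "q \<in> C" "s \<in> C" "p < q" "q < r" "r < s"
  shows "B = C"
  using assms unfolding noncrossing_def by blast

lemma noncrossing_subset: "noncrossing \<pi> \<Longrightarrow> \<rho> \<subseteq> \<pi> \<Longrightarrow> noncrossing \<rho>"
  unfolding noncrossing_def by blast

text \<open>Here \<open>p\<close> is the successor of \<open>a\<close> in the first block. A block
  with points strictly between \<open>a\<close> and \<open>p\<close> cannot reach beyond
  \<open>p\<close> without crossing the first block, so the gap and the part from \<open>p\<close>
  on are partitioned independently, with \<open>p\<close> as the new first point.\<close>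

lemma noncrossing_split:
  assumes ap: "a < p" and pb: "p < b" and B: "B \<subseteq> {p..<b}" "p \<in> B"
  shows "partition_on ({a..<b} - insert a B) \<rho> \<and> noncrossing (insert (insert a B) \<rho>) \<longleftrightarrow>
    (\<exists>\<rho>1 \<rho>2. \<rho> = \<rho>1 \<union> \<rho>2 \<and> (partition_on {Suc a..<p} \<rho>1 \<and> noncrossing \<rho>1) \<and>
      (partition_on ({p..<b} - B) \<rho>2 \<and> noncrossing (insert B \<rho>2)))" (is "?l \<longleftrightarrow> ?r")
proof
  assume l: ?l
  then have part: "partition_on ({a..<b} - insert a B) \<rho>"
      and nc: "noncrossing (insert (insert a B) \<rho>)" by auto
  have Un: "\<Union>\<rho> = {a..<b} - insert a B" and dis: "disjoint \<rho>" and ne: "{} \<notin> \<rho>"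
    using part by (auto simp: partition_on_def)
  define \<rho>1 where "\<rho>1 = {C\<in>\<rho>. C \<subseteq> {Suc a..<p}}"
  define \<rho>2 where "\<rho>2 = {C\<in>\<rho>. C \<subseteq> {p..<b}}"
  \<comment> \<open>A block meeting both sides would cross the first block at some
    \<open>a < q < p < s\<close>.\<close>
  have side: "C \<subseteq> {Suc a..<p} \<or> C \<subseteq> {p..<b}" if C: "C \<in> \<rho>" for C
  proof (rule ccontr)
    assume n: "\<not> ?thesis"
    have sub: "C \<subseteq> {a..<b} - insert a B" using Un C by blast
    obtain s where s: "s \<in> C" "s \<ge> p" using n sub by force
    obtain q where q: "q \<in> C" "q < p" using n sub by force
    have "s \<noteq> p" "q \<noteq> a" "q \<ge> a" using s q sub B by auto
    then have "insert a B = C"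
      using noncrossingD[OF nc, of "insert a B" C a p q s] s q B C by auto
    then show False using sub by auto
  qed
  have eq: "\<rho> = \<rho>1 \<union> \<rho>2" using side by (auto simp: \<rho>1_def \<rho>2_def)
  have U1: "\<Union>\<rho>1 = {Suc a..<p}"
  proof
    show "{Suc a..<p} \<subseteq> \<Union>\<rho>1"
    proof
      fix y assume y: "y \<in> {Suc a..<p}"
      then have "y \<in> \<Union>\<rho>" unfolding Un using B pb by auto
      then obtain C where "C \<in> \<rho>" "y \<in> C" by blast
      then show "y \<in> \<Union>\<rho>1" using side[of C] y by (auto simp: \<rho>1_def)
    qed
  qed (auto simp: \<rho>1_def)
  have U2: "\<Union>\<rho>2 = {p..<b} - B"
  proof
    show "{p..<b} - B \<subseteq> \<Union>\<rho>2"
    proof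
      fix y assume y: "y \<in> {p..<b} - B"
      then have "y \<in> \<Union>\<rho>" unfolding Un using ap by auto
      then obtain C where "C \<in> \<rho>" "y \<in> C" by blast
      then show "y \<in> \<Union>\<rho>2" using side[of C] y by (auto simp: \<rho>2_def)
    qed
  qed (use Un in \<open>auto simp: \<rho>2_def\<close>)
  have p1: "partition_on {Suc a..<p} \<rho>1" and p2: "partition_on ({p..<b} - B) \<rho>2"
    using U1 U2 dis ne by (auto simp: partition_on_def \<rho>1_def \<rho>2_def disjoint_def)
  have nc1: "noncrossing \<rho>1" by (rule noncrossing_subset[OF nc]) (auto simp: \<rho>1_def)
  have nc2: "noncrossing (insert B \<rho>2)"
    unfolding noncrossing_def
  proof (intro ballI allI impI, elim conjE)
    fix C D x y z w
    assume C: "C \<in> insert B \<rho>2" and D: "D \<in> insert B \<rho>2" and *: "x < y" "y < z" "z < w" "x \<in> C"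
        "z \<in> C" "y \<in> D" "w \<in> D"
    \<comment> \<open>Restoring \<open>a\<close> to the block \<open>B\<close> turns a crossing in
      \<open>insert B \<rho>2\<close> into one in the original partition.\<close>
    define e where "e E = (if E = B then insert a B else E)" for E
    have e: "e E \<in> insert (insert a B) \<rho> \<and> E \<subseteq> e E" if "E \<in> insert B \<rho>2" for E
      using that by (auto simp: e_def \<rho>2_def)
    have "e C = e D"
      using noncrossingD[OF nc, of "e C" "e D" x z y w] e[OF C] e[OF D] * by blast
    moreover have "insert a B \<notin> \<rho>2" using ap by (auto simp: \<rho>2_def)
    ultimately show "C = D" using C D by (auto simp: e_def split: if_splits)
  qed
  show ?r using eq p1 p2 nc1 nc2 by blast
next
  assume ?r
  then obtain \<rho>1 \<rho>2 where eq: "\<rho> = \<rho>1 \<union> \<rho>2" and p1: "partition_on {Suc a..<p} \<rho>1"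
      and nc1: "noncrossing \<rho>1"
    and p2: "partition_on ({p..<b} - B) \<rho>2" and nc2: "noncrossing (insert B \<rho>2)" by blast
  have s1: "C \<subseteq> {Suc a..<p}" if "C \<in> \<rho>1" for C using p1 that by (auto simp: partition_on_def)
  have s2: "C \<subseteq> {p..<b} - B" if "C \<in> \<rho>2" for C using p2 that by (auto simp: partition_on_def)
  have Un: "\<Union>\<rho> = {a..<b} - insert a B"
  proof -
    have "\<Union>\<rho> = {Suc a..<p} \<union> ({p..<b} - B)" using p1 p2 eq by (auto simp: partition_on_def)
    also have "\<dots> = {a..<b} - insert a B" using B ap pb by auto
    finally show ?thesis .
  qed
  have cross: "C \<inter> D = {}" if "C \<in> \<rho>1" "D \<in> \<rho>2" for C D using s1[OF that(1)] s2[OF that(2)] by fastforce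
  have "disjoint \<rho>1" "disjoint \<rho>2" using p1 p2 by (auto simp: partition_on_def)
  have "disjoint \<rho>"
    unfolding disjoint_def
  proof (intro ballI impI)
    fix C D assume "C \<in> \<rho>" "D \<in> \<rho>" "C \<noteq> D"
    then show "C \<inter> D = {}"
      using cross[of C D] cross[of D C] disjointD[OF \<open>disjoint \<rho>1\<close>, of C D] disjointD[OF \<open>disjoint \<rho>2\<close>, of C D] eq
      by blast
  qed
  then have part: "partition_on ({a..<b} - insert a B) \<rho>"
    using Un p1 p2 eq by (auto simp: partition_on_def)
  have nc: "noncrossing (insert (insert a B) \<rho>)"
    unfolding noncrossing_def
  proof (intro ballI allI impI, elim conjE)
    fix C D x y z w
    assume C: "C \<in> insert (insert a B) \<rho>" and D: "D \<in> insert (insert a B) \<rho>"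
      and *: "x < y" "y < z" "z < w" "x \<in> C" "z \<in> C" "y \<in> D" "w \<in> D"
    have B': "y \<in> B \<Longrightarrow> p \<le> y" for y using B by auto
    consider "C = insert a B" "D = insert a B" | "C = insert a B" "D \<in> \<rho>1" | "C = insert a B" "D \<in> \<rho>2"
      | "C \<in> \<rho>1" "D = insert a B" | "C \<in> \<rho>1" "D \<in> \<rho>1" | "C \<in> \<rho>1" "D \<in> \<rho>2"
      | "C \<in> \<rho>2" "D = insert a B" | "C \<in> \<rho>2" "D \<in> \<rho>1" | "C \<in> \<rho>2" "D \<in> \<rho>2"
    proof -
      have "C = insert a B \<or> C \<in> \<rho>1 \<or> C \<in> \<rho>2" "D = insert a B \<or> D \<in> \<rho>1 \<or> D \<in> \<rho>2"
        using C D eq by auto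
      then show ?thesis using that by argo
    qed
    then show "C = D"
    proof cases
      case 2
      have "a < y" "w < p" using s1[OF 2(2)] * by auto
      then have "z \<in> B" "z < p" using * 2 by auto
      then show ?thesis using B'[of z] by simp
    next
      \<comment> \<open>The point \<open>x\<close> may be \<open>a\<close>, which \<open>B\<close>
        lacks; since \<open>p\<close> is in \<open>B\<close> and \<open>p < y\<close>, it takes over
        the role of \<open>x\<close> in the crossing.\<close>
      case 3
      have y: "p \<le> y" "y \<noteq> p" using s2[OF 3(2)] * B by auto
      then have z: "z \<in> B" using * 3 ap by auto
      have "B = D" using noncrossingD[OF nc2, of B D p z y w] y z 3 * B by auto
      then show ?thesis using s2[OF 3(2)] B by auto
    next
      case 4
      have "a < x" "z < p" using s1[OF 4(1)] * by auto
      then have "y \<in> B" "y < p" using * 4 by auto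
      then show ?thesis using B'[of y] by simp
    next
      case 5 then show ?thesis using noncrossingD[OF nc1, of C D x z y w] * by simp
    next
      case 6 then show ?thesis using s1[OF 6(1)] s2[OF 6(2)] * by force
    next
      case 7
      have x: "p \<le> x" using s2[OF 7(1)] * by auto
      then have z: "y \<in> B" "w \<in> B" using * 7 ap by auto
      have "C = B" using noncrossingD[OF nc2, of C B x z y w] z 7 * by auto
      then show ?thesis using s2[OF 7(1)] B by auto
    next
      case 8 then show ?thesis using s1[OF 8(2)] s2[OF 8(1)] * by force
    next
      case 9 then show ?thesis using noncrossingD[OF nc2, of C D x z y w] * by simp
    qed simp
  qed
  show ?l using part nc by blast
qed

text \<open>By \<open>noncrossing_split\<close> the partitions are exactly the unions of independent
  pairs, and the weight of a disjoint union is the product of the weights.\<close>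

lemma nc_sum_block_split:
  assumes ap: "a < p" and pb: "p < b" and B: "B \<subseteq> {p..<b}" "p \<in> B"
  shows "nc_sum_block u a b (insert a B) = nc_sum u (Suc a) p * nc_sum_block u p b B"
proof -
  let ?R1 = "{\<rho>. partition_on {Suc a..<p} \<rho> \<and> noncrossing \<rho>}"
  let ?R2 = "{\<rho>. partition_on ({p..<b} - B) \<rho> \<and> noncrossing (insert B \<rho>)}"
  let ?R = "{\<rho>. partition_on ({a..<b} - insert a B) \<rho> \<and> noncrossing (insert (insert a B) \<rho>)}"
  have f1: "finite \<rho>" if "\<rho> \<in> ?R1" for \<rho> using that by (auto intro: finite_elements[of "{Suc a..<p}"])
  have f2: "finite \<rho>" if "\<rho> \<in> ?R2" for \<rho> using that by (auto intro: finite_elements[of "{p..<b} - B"])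
  \<comment> \<open>No nonempty block lies in both intervals, so the two parts can be read off from
    their union by position. This yields disjointness for the weights and injectivity of the union
    map.\<close>
  have d: "\<rho>1 = {C \<in> \<rho>1 \<union> \<rho>2. C \<subseteq> {Suc a..<p}} \<and> \<rho>2 = {C \<in> \<rho>1 \<union> \<rho>2. C \<subseteq> {p..<b}} \<and> \<rho>1 \<inter> \<rho>2 = {}"
    if 1: "\<rho>1 \<in> ?R1" and 2: "\<rho>2 \<in> ?R2" for \<rho>1 \<rho>2
  proof -
    have a1: "C \<subseteq> {Suc a..<p} \<and> C \<noteq> {}" if "C \<in> \<rho>1" for C using 1 that by (auto simp: partition_on_def)
    have a2: "C \<subseteq> {p..<b} \<and> C \<noteq> {}" if "C \<in> \<rho>2" for C using 2 that by (auto simp: partition_on_def)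
    have a3: "\<not> (C \<subseteq> {Suc a..<p} \<and> C \<subseteq> {p..<b} \<and> C \<noteq> {})" for C by fastforce
    show ?thesis using a1 a2 a3 by blast
  qed
  have "nc_sum u (Suc a) p * nc_sum_block u p b B =
      (\<Sum>(\<rho>1, \<rho>2)\<in>?R1 \<times> ?R2. partition_weight u \<rho>1 * partition_weight u \<rho>2)"
    unfolding nc_sum_def nc_sum_block_def sum_product by (simp add: sum.cartesian_product)
  also have "\<dots> = (\<Sum>x\<in>?R1 \<times> ?R2. partition_weight u ((\<lambda>(\<rho>1, \<rho>2). \<rho>1 \<union> \<rho>2) x))"
  proof (rule sum.cong[OF refl], clarify)
    fix \<rho>1 \<rho>2
    assume "partition_on {Suc a..<p} \<rho>1" "noncrossing \<rho>1" "partition_on ({p..<b} - B) \<rho>2"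
        "noncrossing (insert B \<rho>2)"
    then have "\<rho>1 \<in> ?R1" "\<rho>2 \<in> ?R2" by auto
    from d[OF this] f1[OF this(1)] f2[OF this(2)]
    show "partition_weight u \<rho>1 * partition_weight u \<rho>2 = partition_weight u (\<rho>1 \<union> \<rho>2)"
      by (simp add: partition_weight_def prod.union_disjoint)
  qed
  also have "\<dots> = (\<Sum>\<rho>\<in>?R. partition_weight u \<rho>)"
  proof (rule sum.reindex_bij_betw, rule bij_betw_imageI)
    show "inj_on (\<lambda>(\<rho>1, \<rho>2). \<rho>1 \<union> \<rho>2) (?R1 \<times> ?R2)"
    proof (rule inj_onI)
      fix x y assume "x \<in> ?R1 \<times> ?R2" "y \<in> ?R1 \<times> ?R2"
        and "(\<lambda>(\<rho>1, \<rho>2). \<rho>1 \<union> \<rho>2) x = (\<lambda>(\<rho>1, \<rho>2). \<rho>1 \<union> \<rho>2) y"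
      then have x: "fst x \<in> ?R1" "snd x \<in> ?R2" and y: "fst y \<in> ?R1" "snd y \<in> ?R2"
        and e: "fst x \<union> snd x = fst y \<union> snd y" by (auto simp: split_beta)
      have "fst x = fst y" using d[OF x] d[OF y] e by metis
      moreover have "snd x = snd y" using d[OF x] d[OF y] e by metis
      ultimately show "x = y" by (simp add: prod_eq_iff)
    qed
    show "(\<lambda>(\<rho>1, \<rho>2). \<rho>1 \<union> \<rho>2) ` (?R1 \<times> ?R2) = ?R"
    proof (rule set_eqI)
      fix \<rho>
      show "\<rho> \<in> (\<lambda>(\<rho>1, \<rho>2). \<rho>1 \<union> \<rho>2) ` (?R1 \<times> ?R2) \<longleftrightarrow> \<rho> \<in> ?R"
        unfolding mem_Collect_eq noncrossing_split[OF assms]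
            by (simp add: image_iff Bex_def conj_assoc) blast
    qed
  qed
  finally show ?thesis by (simp add: nc_sum_block_def)
qed

text \<open>A crossing takes two points from each of its blocks, so the singleton \<open>{a}\<close>
  never takes part in one.\<close>

lemma first_block_sum_0:
  assumes "a < b" shows "first_block_sum u a b 0 = nc_sum u (Suc a) b"
proof -
  have "{B. B \<subseteq> {Suc a..<b} \<and> card B = 0} = {{}}" by (auto dest: finite_subset)
  moreover have "{a..<b} - {a} = {Suc a..<b}" by auto
  moreover have "noncrossing (insert {a} \<rho>) \<longleftrightarrow> noncrossing \<rho>" if "partition_on {Suc a..<b} \<rho>" for \<rho>
  proof
    assume nc: "noncrossing \<rho>"
    have s: "C \<subseteq> {Suc a..<b}" if "C \<in> \<rho>" for C using that \<open>partition_on _ \<rho>\<close>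
        by (auto simp: partition_on_def)
    show "noncrossing (insert {a} \<rho>)"
      unfolding noncrossing_def
    proof (intro ballI allI impI, elim conjE)
      fix C D x y z w
      assume C: "C \<in> insert {a} \<rho>" and D: "D \<in> insert {a} \<rho>"
        and *: "x < y" "y < z" "z < w" "x \<in> C" "z \<in> C" "y \<in> D" "w \<in> D"
      then have "C \<in> \<rho>" "D \<in> \<rho>" by auto
      then show "C = D" using noncrossingD[OF nc, of C D x z y w] * by simp
    qed
  qed (auto intro: noncrossing_subset)
  ultimately show ?thesis
    by (auto simp: first_block_sum_def nc_sum_block_def nc_sum_def intro!: sum.cong)
qed

text \<open>The sum is sorted by the second smallest element \<open>p\<close> of the first block:
  the gap before \<open>p\<close> splits off as a factor, and \<open>p\<close> becomes the first
  point of the remaining block.\<close>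

lemma first_block_sum_Suc:
  "first_block_sum u a b (Suc s) = (\<Sum>p\<in>{Suc a..<b}. nc_sum u (Suc a) p * first_block_sum u p b s)"
proof -
  let ?S = "\<lambda>p. {B. B \<subseteq> {Suc p..<b} \<and> card B = s}"
  have fin: "finite B" if "B \<subseteq> {Suc p..<b}" for p B using that finite_subset by blast
  have "(\<Sum>p\<in>{Suc a..<b}. nc_sum u (Suc a) p * first_block_sum u p b s) =
      (\<Sum>p\<in>{Suc a..<b}. \<Sum>B\<in>?S p. nc_sum_block u a b (insert a (insert p B)))"
    unfolding first_block_sum_def sum_distrib_left
    by (intro sum.cong refl nc_sum_block_split[symmetric]) auto
  also have "\<dots> = (\<Sum>(p, B)\<in>Sigma {Suc a..<b} ?S. nc_sum_block u a b (insert a (insert p B)))"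
    by (intro sum.Sigma) auto
  also have "\<dots> = (\<Sum>B | B \<subseteq> {Suc a..<b} \<and> card B = Suc s. nc_sum_block u a b (insert a B))"
  proof (rule sum.reindex_bij_witness[where j = "\<lambda>(p, B). insert p B"
      and i = "\<lambda>B. (Min B, B - {Min B})"])
    fix x assume "x \<in> Sigma {Suc a..<b} ?S"
    then obtain p B where [simp]: "x = (p, B)" and p: "p \<in> {Suc a..<b}" and B: "B \<subseteq> {Suc p..<b}"
        "card B = s"
      by (cases x) auto
    have fB: "finite B" using B fin by blast
    have pB: "p \<notin> B" using B by auto
    have "Min (insert p B) = p" by (rule Min_eqI) (use B fB in auto)
    then show "(case case x of (p, B) \<Rightarrow> insert p B of B \<Rightarrow> (Min B, B - {Min B})) = x" using pB by simp
    show "(case x of (p, B) \<Rightarrow> insert p B) \<in> {B. B \<subseteq> {Suc a..<b} \<and> card B = Suc s}"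
      using p B pB fB by auto
    show "nc_sum_block u a b (insert a (case x of (p, B) \<Rightarrow> insert p B)) =
         (case x of (p, B) \<Rightarrow> nc_sum_block u a b (insert a (insert p B)))" by simp
  next
    fix B assume "B \<in> {B. B \<subseteq> {Suc a..<b} \<and> card B = Suc s}"
    then have B: "B \<subseteq> {Suc a..<b}" "card B = Suc s" by auto
    have fB: "finite B" and ne: "B \<noteq> {}" using B fin by auto
    have m: "Min B \<in> B" using fB ne by simp
    then show "(case (Min B, B - {Min B}) of (p, B) \<Rightarrow> insert p B) = B" by auto
    have "y > Min B" if "y \<in> B - {Min B}" for y using that fB
        by (metis DiffE Min_le insertCI le_neq_implies_less)
    then have "B - {Min B} \<subseteq> {Suc (Min B)..<b}" using B by fastforce
    then show "(Min B, B - {Min B}) \<in> Sigma {Suc a..<b} ?S" using B m fB by auto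
  qed
  finally show ?thesis by (simp add: first_block_sum_def)
qed

lemma nc_sum_first_block:
  assumes "a < b"
  shows "nc_sum u a b = (\<Sum>s<b - a. u (Suc s) * first_block_sum u a b s)"
proof -
  have ab: "{a..<b} = insert a {Suc a..<b}" using assms by auto
  have d: "{Suc a..<b} - B = {a..<b} - insert a B" for B by auto
  have "nc_sum u a b = (\<Sum>B\<in>Pow {Suc a..<b}. u (Suc (card B)) * nc_sum_block u a b (insert a B))"
    unfolding nc_sum_def ab
    by (subst sum_partitions_insert) (auto simp: nc_sum_block_def d[symmetric])
  also have "\<dots> = (\<Sum>s<b - a. \<Sum>B | B \<in> Pow {Suc a..<b} \<and> card B = s. u (Suc (card B)) * nc_sum_block u a b (insert a B))"
  proof (rule sum.group[symmetric])
    show "card ` Pow {Suc a..<b} \<subseteq> {..<b - a}"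
    proof safe
      fix B assume "B \<subseteq> {Suc a..<b}"
      then have "card B \<le> card {Suc a..<b}" by (intro card_mono) auto
      then show "card B < b - a" using assms by simp
    qed
  qed auto
  also have "\<dots> = (\<Sum>s<b - a. u (Suc s) * first_block_sum u a b s)"
    unfolding first_block_sum_def sum_distrib_left by (intro sum.cong) auto
  finally show ?thesis .
qed

text \<open>Iterating \<open>first_block_sum_Suc\<close> gives a convolution over the
  \<open>Suc s\<close> gaps after the block elements, each element adding a factor
  \<open>fps_X\<close>. Translation invariance is assumed for shorter intervals only, so that the
  lemma can serve inside the induction for \<open>nc_sum_translation\<close>.\<close>

lemma first_block_sum_fps:
  fixes u :: "nat \<Rightarrow> real"
  defines "F \<equiv> Abs_fps (nc_sum u 0)"
  assumes "a < b" "\<And>a' b'. b' - a' < b - a \<Longrightarrow> nc_sum u a' b' = F $ (b' - a')"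
  shows "first_block_sum u a b s = (fps_X * F) ^ Suc s $ (b - a)"
  using assms(2,3)
proof (induction s arbitrary: a b)
  case 0
  then show ?case by (simp add: first_block_sum_0 Suc_diff_Suc fps_X_mult_nth[of F] diff_less_mono2)
next
  case (Suc s)
  let ?G = "(fps_X * F) ^ Suc s"
  define n where "n = b - Suc a"
  have n: "b - a = Suc n" using Suc.prems by (simp add: n_def)
  have "first_block_sum u a b (Suc s) = (\<Sum>p\<in>{Suc a..<b}. F $ (p - Suc a) * ?G $ (b - p))"
    unfolding first_block_sum_Suc
  proof (intro sum.cong refl arg_cong2[where f = "(*)"])
    fix p assume p: "p \<in> {Suc a..<b}"
    show "nc_sum u (Suc a) p = F $ (p - Suc a)" using p by (intro Suc.prems) auto
    show "first_block_sum u p b s = ?G $ (b - p)" using p by (intro Suc.IH Suc.prems) auto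
  qed
  also have "\<dots> = (\<Sum>i<n. F $ i * ?G $ (n - i))"
    by (rule sum.reindex_bij_witness[of _ "\<lambda>i. i + Suc a" "\<lambda>p. p - Suc a"]) (auto simp: n_def)
  \<comment> \<open>The added term \<open>i = n\<close> vanishes because \<open>?G\<close> has
    constant coefficient 0.\<close>
  also have "\<dots> = (\<Sum>i\<le>n. F $ i * ?G $ (n - i))"
    by (simp add: lessThan_Suc_atMost[symmetric])
  also have "\<dots> = (fps_X * (F * ?G)) $ (b - a)"
    unfolding n by (subst fps_X_mult_nth) (simp add: fps_mult_nth atLeast0AtMost del: power_Suc)
  finally show ?case by (simp add: mult_ac)
qed

text \<open>Strong induction on the length: sorting by the size of the first block gives both sides
  the same coefficient formula, once the claim is known for shorter intervals.\<close>

lemma nc_sum_translation: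
  "nc_sum u a b = nc_sum u 0 (b - a)"
proof (induction "b - a" arbitrary: a b rule: less_induct)
  case less
  let ?F = "Abs_fps (nc_sum u 0)"
  have IH: "nc_sum u a' b' = ?F $ (b' - a')" if "b' - a' < b - a" for a' b'
    using less[OF that] by simp
  show ?case
  proof (cases "a < b")
    case True
    have "nc_sum u a b = (\<Sum>s<b - a. u (Suc s) * (fps_X * ?F) ^ Suc s $ (b - a))"
      unfolding nc_sum_first_block[OF True] using first_block_sum_fps[OF True IH] by simp
    moreover have "nc_sum u 0 (b - a) = (\<Sum>s<b - a. u (Suc s) * (fps_X * ?F) ^ Suc s $ (b - a))"
      using True by (subst nc_sum_first_block) (auto simp: first_block_sum_fps[OF _ IH])
    ultimately show ?thesis by simp
  qed (simp add: nc_sum_def)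
qed

section \<open>Power series form of the free moment-cumulant relation\<close>

definition moment_fps :: "seq \<Rightarrow> real fps" where
  "moment_fps m = Abs_fps (with_unit m)"

lemma moment_fps_free_moments:
  "moment_fps (free_moments c) = Abs_fps (nc_sum (\<lambda>k. c (k - 1)) 0)"
proof (rule fps_ext)
  fix n show "moment_fps (free_moments c) $ n = Abs_fps (nc_sum (\<lambda>k. c (k - 1)) 0) $ n"
  proof (cases n)
    case 0
    have "noncrossing {}" by (simp add: noncrossing_def)
    then have "{\<pi>. partition_on {} \<pi> \<and> noncrossing \<pi>} = {{}}" by (auto simp: partition_on_empty)
    with 0 show ?thesis by (simp add: moment_fps_def nc_sum_def partition_weight_def)
  next
    case (Suc i)
    have "{1..Suc i} = {1..<Suc (Suc i)}" by auto
    then have "free_moments c i = nc_sum (\<lambda>k. c (k - 1)) 1 (Suc (Suc i))"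
      by (simp add: free_moments_def nc_sum_def partition_weight_def)
    then show ?thesis using nc_sum_translation[of _ 1 "Suc (Suc i)"] Suc by (simp add: moment_fps_def)
  qed
qed

text \<open>This is the equation \<open>F = 1 + (\<Sum>j. c j * (X * F) ^ Suc j)\<close> for the
  moment series \<open>F\<close>, read at order \<open>Suc k\<close>. For \<open>j = k\<close> the
  factor of \<open>c k\<close> is the constant coefficient of a power of \<open>F\<close>, which is
  1.\<close>

lemma free_moments_rec:
  "free_moments c k = (\<Sum>j\<le>k. c j * (moment_fps (free_moments c) ^ Suc j $ (k - j)))"
proof -
  let ?F = "moment_fps (free_moments c)"
  have "free_moments c k = ?F $ Suc k" by (simp add: moment_fps_def)
  also have "\<dots> = nc_sum (\<lambda>k. c (k - 1)) 0 (Suc k)" by (simp add: moment_fps_free_moments)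
  also have "\<dots> = (\<Sum>s<Suc k. c s * (fps_X * ?F) ^ Suc s $ Suc k)"
    unfolding moment_fps_free_moments using nc_sum_translation
    by (subst nc_sum_first_block) (auto simp: first_block_sum_fps simp del: power_Suc)
  also have "\<dots> = (\<Sum>j\<le>k. c j * (?F ^ Suc j $ (k - j)))"
    by (intro sum.cong) (auto simp: power_mult_distrib fps_X_power_mult_nth simp del: power_Suc)
  finally show ?thesis .
qed

section \<open>Linearization for triangular moment recursions\<close>

text \<open>Curves are used because the cumulant map bends the line
  \<open>x + \<epsilon> * y\<close>; derivatives along lines alone would not compose.\<close>

definition has_curve_derivative :: "(real \<Rightarrow> seq) \<Rightarrow> seq \<Rightarrow> bool" where
  "has_curve_derivative x y \<longleftrightarrow> (\<forall>k. ((\<lambda>\<epsilon>. x \<epsilon> k) has_real_derivative y k) (at 0))"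

text \<open>Stands for the infinite combination of all \<open>v n\<close> with coefficients
  \<open>z n\<close>: when \<open>v n k = 0\<close> for \<open>k < n\<close>, the sum in coordinate
  \<open>k\<close> stops at \<open>k\<close>.\<close>

definition expansion :: "(nat \<Rightarrow> seq) \<Rightarrow> seq \<Rightarrow> seq" where
  "expansion v z = (\<lambda>k. \<Sum>n\<le>k. z n * v n k)"

lemma tendsto_seqI:
  fixes f :: "'b \<Rightarrow> seq"
  assumes "\<And>i. ((\<lambda>\<epsilon>. f \<epsilon> i) \<longlongrightarrow> d i) F"
  shows "(f \<longlongrightarrow> d) F"
  using assms
proof -
  have "limitin (product_topology (\<lambda>i. euclidean) UNIV) f d F"
    unfolding limitin_componentwise using assms by simp
  then show ?thesis by (simp add: euclidean_product_topology)
qed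

lemma has_gateaux_derivativeI:
  assumes "has_curve_derivative (\<lambda>\<epsilon>. A (\<lambda>j. x j + \<epsilon> * y j)) d"
  shows "has_gateaux_derivative A x y d"
  unfolding has_gateaux_derivative_def
proof (rule tendsto_seqI)
  fix i
  have "((\<lambda>\<epsilon>. A (\<lambda>j. x j + \<epsilon> * y j) i) has_real_derivative d i) (at 0)"
    using assms by (simp add: has_curve_derivative_def)
  then show "((\<lambda>\<epsilon>. (A (\<lambda>j. x j + \<epsilon> * y j) i - A x i) / \<epsilon>) \<longlongrightarrow> d i) (at 0)"
    by (simp add: DERIV_def)
qed

text \<open>Pairwise distinct scaling factors are what makes the eigenspaces
  one-dimensional.\<close>

lemma eigenvalue_inj:
  "(2::real) powr (1 - real (Suc n) / 2) = 2 powr (1 - real (Suc k) / 2) \<longleftrightarrow> n = k"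
  by (subst powr_inj) (auto simp: field_simps)

text \<open>The positive and negative parts are dominated by the absolute value of \<open>f\<close>,
  so the integrals split and all data of the pair of measures reduce to Lebesgue integrals of
  \<open>f\<close>.\<close>

lemma signed_density_moments:
  assumes f: "f \<in> borel_measurable borel" and int: "\<And>k. integrable lborel (\<lambda>x. x ^ k * f x)"
  shows "finite_moments (signed_density f)" "total_mass (signed_density f) = (\<integral>x. f x \<partial>lborel)"
    "signed_moment_seq (signed_density f) = (\<lambda>i. \<integral>x. x ^ Suc i * f x \<partial>lborel)"
proof -
  define p where "p x = max 0 (f x)" for x
  define q where "q x = max 0 (- f x)" for x
  have pq: "p x - q x = f x" "0 \<le> p x" "0 \<le> q x" for x by (auto simp: p_def q_def)
  have [measurable]: "f \<in> borel_measurable borel" by fact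
  have [measurable]: "p \<in> borel_measurable borel" "q \<in> borel_measurable borel"
    unfolding p_def[abs_def] q_def[abs_def] by measurable
  have sd: "signed_density f = (density lborel (\<lambda>x. ennreal (p x)), density lborel (\<lambda>x. ennreal (q x)))"
  proof -
    have "ennreal (f x) = ennreal (p x)" "ennreal (- f x) = ennreal (q x)" for x
      by (auto simp: p_def q_def max_def ennreal_neg)
    then show ?thesis by (simp add: signed_density_def)
  qed
  have ip: "integrable lborel (\<lambda>x. x ^ k * p x)" "integrable lborel (\<lambda>x. x ^ k * q x)" for k
    by (rule Bochner_Integration.integrable_bound[OF int[of k]];
        auto simp: p_def q_def abs_mult intro!: mult_left_mono)+
  have id: "integrable (density lborel (\<lambda>x. ennreal (g x))) (\<lambda>x. x ^ k) \<longleftrightarrow> integrable lborel (\<lambda>x. x ^ k * g x)"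
    "(\<integral>x. x ^ k \<partial>density lborel (\<lambda>x. ennreal (g x))) = (\<integral>x. x ^ k * g x \<partial>lborel)"
    if [measurable]: "g \<in> borel_measurable borel" and "\<And>x. 0 \<le> g x" for g k
    using that by (auto simp: integrable_density integral_density mult.commute)
  have fin: "finite_measure (density lborel (\<lambda>x. ennreal (g x)))"
    if [measurable]: "g \<in> borel_measurable borel" and "\<And>x. 0 \<le> g x" "integrable lborel g"
        for g :: "real \<Rightarrow> real"
    using that by (intro finite_measureI) (auto simp: emeasure_density nn_integral_eq_integral)
  have m: "measure (density lborel (\<lambda>x. ennreal (g x))) UNIV = (\<integral>x. g x \<partial>lborel)"
    if [measurable]: "g \<in> borel_measurable borel" and "\<And>x. 0 \<le> g x" "integrable lborel g" for g
    using that by (simp add: measure_def emeasure_density nn_integral_eq_integral)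
  have i0: "integrable lborel p" "integrable lborel q" using ip[of 0] by auto
  have pm: "p \<in> borel_measurable borel" and qm: "q \<in> borel_measurable borel" by measurable
  note id_p = id[OF pm pq(2)] and id_q = id[OF qm pq(3)]
  note fin_p = fin[OF pm pq(2) i0(1)] and fin_q = fin[OF qm pq(3) i0(2)]
  show "finite_moments (signed_density f)"
    unfolding sd finite_moments_def fst_conv snd_conv using fin_p fin_q ip by (simp add: id_p id_q)
  have "(\<integral>x. p x \<partial>lborel) - (\<integral>x. q x \<partial>lborel) = (\<integral>x. p x - q x \<partial>lborel)"
    by (rule Bochner_Integration.integral_diff[OF i0, symmetric])
  then show "total_mass (signed_density f) = (\<integral>x. f x \<partial>lborel)"
    unfolding sd total_mass_def fst_conv snd_conv m[OF pm pq(2) i0(1)] m[OF qm pq(3) i0(2)] pq(1) .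
  have "(\<integral>x. x ^ k * p x \<partial>lborel) - (\<integral>x. x ^ k * q x \<partial>lborel) = (\<integral>x. x ^ k * f x \<partial>lborel)" for k
    unfolding Bochner_Integration.integral_diff[OF ip, symmetric] right_diff_distrib[symmetric] pq(1) ..
  then show "signed_moment_seq (signed_density f) = (\<lambda>i. \<integral>x. x ^ Suc i * f x \<partial>lborel)"
    unfolding sd signed_moment_seq_def moment_def fst_conv snd_conv id_p id_q by (simp del: power_Suc)
qed

text \<open>
  \<open>c0\<close> and \<open>m0\<close> are the cumulants and moments of the fixed point, \<open>da k j\<close> is the derivative of
  \<open>a k j\<close> at \<open>m0\<close>, and \<open>v n\<close> is the derivative of \<open>M\<close> at \<open>c0\<close> in the direction of the \<open>n\<close>-th unit
  vector, so that \<open>expansion v\<close> is the full derivative.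
\<close>

locale triangular_moments =
  fixes M :: "seq \<Rightarrow> seq" and a :: "nat \<Rightarrow> nat \<Rightarrow> seq \<Rightarrow> real"
    and da :: "nat \<Rightarrow> nat \<Rightarrow> seq \<Rightarrow> real" and w :: "nat \<Rightarrow> real" and c0 m0 :: seq and v :: "nat \<Rightarrow> seq"
  assumes bij_M: "bij M"
    and M_rec: "M c k = (\<Sum>j\<le>k. c j * a k j (M c))"
    and a_diag: "a k k m = w k" and w_nonzero: "w k \<noteq> 0"
    and a_deriv: "j \<le> k \<Longrightarrow> x 0 = m0 \<Longrightarrow> (\<And>i. i < k \<Longrightarrow> ((\<lambda>\<epsilon>. x \<epsilon> i) has_real_derivative z i) (at 0)) \<Longrightarrow>
      ((\<lambda>\<epsilon>. a k j (x \<epsilon>)) has_real_derivative da k j z) (at 0)"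
    and da_sum: "da k j (\<lambda>i. \<Sum>n\<in>(N :: nat set). s n * Y n i) = (\<Sum>n\<in>N. s n * da k j (Y n))"
    and da_cong: "(\<And>i. i < k \<Longrightarrow> y i = z i) \<Longrightarrow> da k j y = da k j z"
    and M_c0: "M c0 = m0"
    and c0_fixed: "cumulant_scaling c0 = c0"
    and v_lower: "k < n \<Longrightarrow> v n k = 0"
    and v_rec: "n \<le> k \<Longrightarrow> v n k = a k n m0 + (\<Sum>j\<le>k. c0 j * da k j (v n))"
begin

text \<open>By \<open>a_diag\<close> the function \<open>a k k\<close> is constant, so uniqueness of
  derivatives applies along any line through \<open>m0\<close>.\<close>

lemma da_diag: "da k k z = 0"
proof -
  have "((\<lambda>\<epsilon>::real. m0 i + \<epsilon> * z i) has_real_derivative z i) (at 0)" for i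
    by (auto intro!: derivative_eq_intros)
  from a_deriv[of k k "\<lambda>\<epsilon> i. m0 i + \<epsilon> * z i" z, OF _ _ this]
  have "((\<lambda>\<epsilon>::real. w k) has_real_derivative da k k z) (at 0)" by (simp add: a_diag)
  then show ?thesis using DERIV_const DERIV_unique by blast
qed

lemma da_zero: "(\<And>i. i < k \<Longrightarrow> z i = 0) \<Longrightarrow> da k j z = 0"
  \<comment> \<open>The empty sum in \<open>da_sum\<close> gives the value 0 at the zero
    sequence.\<close>
  using da_cong[of k z "\<lambda>i. 0" j] da_sum[where N = "{}" and k = k and j = j] by simp

lemma v_diag: "v n n = w n"
  unfolding v_rec[OF order_refl] by (simp add: a_diag da_zero v_lower)

text \<open>This is \<open>M_rec\<close> differentiated by the product rule at \<open>c0\<close> in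
  direction \<open>z\<close>; it follows from the case of unit vectors, \<open>v_rec\<close>, by
  linearity of \<open>da\<close>.\<close>

lemma expansion_rec:
  "expansion v z k = (\<Sum>j\<le>k. z j * a k j m0 + c0 j * da k j (expansion v z))"
proof -
  \<comment> \<open>A common upper limit \<open>k\<close> for all \<open>i < k\<close> turns the
    relevant coordinates into one finite combination, to which \<open>da_sum\<close>
    applies.\<close>
  have ext: "expansion v z i = (\<Sum>n\<le>k. z n * v n i)" if "i < k" for i
    unfolding expansion_def using that by (intro sum.mono_neutral_left) (auto simp: v_lower)
  have "expansion v z k = (\<Sum>n\<le>k. z n * a k n m0) + (\<Sum>n\<le>k. \<Sum>j\<le>k. c0 j * (z n * da k j (v n)))"
    by (simp add: expansion_def v_rec distrib_left sum.distrib sum_distrib_left mult_ac)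
  also have "(\<Sum>n\<le>k. \<Sum>j\<le>k. c0 j * (z n * da k j (v n))) = (\<Sum>j\<le>k. c0 j * da k j (\<lambda>i. \<Sum>n\<le>k. z n * v n i))"
    by (subst sum.swap) (simp add: da_sum sum_distrib_left)
  also have "\<dots> = (\<Sum>j\<le>k. c0 j * da k j (expansion v z))"
    using da_cong[OF ext] by simp
  finally show ?thesis by (simp add: sum.distrib)
qed

section \<open>Differentiating moments and cumulants along curves\<close>

lemma bij_expansion: "bij (expansion v)"
proof (rule bij_triangular[where a = w and G = "\<lambda>z i. \<Sum>n<i. z n * v n i"])
  show "expansion v z i = w i * z i + (\<Sum>n<i. z n * v n i)" for z i
    by (simp add: expansion_def lessThan_Suc_atMost[symmetric] v_diag)
qed (auto simp: w_nonzero)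

text \<open>Induction on the coordinate: the coefficients in \<open>M_rec\<close> at
  \<open>k\<close> involve only earlier moments, and the product rule reproduces
  \<open>expansion_rec\<close>.\<close>

lemma curve_derivative_moments:
  assumes c: "has_curve_derivative c z" and c0: "c 0 = c0"
  shows "has_curve_derivative (\<lambda>\<epsilon>. M (c \<epsilon>)) (expansion v z)"
proof -
  have "((\<lambda>\<epsilon>. M (c \<epsilon>) k) has_real_derivative expansion v z k) (at 0)" for k
  proof (induction k rule: less_induct)
    case (less k)
    have "((\<lambda>\<epsilon>. \<Sum>j\<le>k. c \<epsilon> j * a k j (M (c \<epsilon>))) has_real_derivative
        (\<Sum>j\<le>k. z j * a k j m0 + c0 j * da k j (expansion v z))) (at 0)"
    proof (rule DERIV_sum)
      fix j assume "j \<in> {..k}"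
      then have "((\<lambda>\<epsilon>. a k j (M (c \<epsilon>))) has_real_derivative da k j (expansion v z)) (at 0)"
        using less by (intro a_deriv) (auto simp: c0 M_c0)
      moreover have "((\<lambda>\<epsilon>. c \<epsilon> j) has_real_derivative z j) (at 0)"
        using c by (simp add: has_curve_derivative_def)
      ultimately show "((\<lambda>\<epsilon>. c \<epsilon> j * a k j (M (c \<epsilon>))) has_real_derivative
          z j * a k j m0 + c0 j * da k j (expansion v z)) (at 0)"
        by (auto intro!: derivative_eq_intros simp: c0 M_c0)
    qed
    then show ?case by (simp only: M_rec[symmetric] expansion_rec[symmetric])
  qed
  then show ?thesis by (simp add: has_curve_derivative_def)
qed

text \<open>Since \<open>a k k\<close> is the nonzero constant \<open>w k\<close>,
  \<open>M_rec\<close> can be solved for the cumulant at \<open>k\<close> in terms of the moments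
  and the earlier cumulants, and then differentiated by induction on \<open>k\<close>.\<close>

lemma curve_derivative_cumulants:
  assumes m: "has_curve_derivative m (expansion v z)" and m0: "m 0 = m0"
  shows "has_curve_derivative (\<lambda>\<epsilon>. inv M (m \<epsilon>)) z"
proof -
  define c where "c \<epsilon> = inv M (m \<epsilon>)" for \<epsilon>
  have Mc: "M (c \<epsilon>) = m \<epsilon>" for \<epsilon> using bij_M by (simp add: c_def bij_is_surj surj_f_inv_f)
  have c0: "c 0 = c0" using bij_M M_c0 m0 by (metis Mc bij_pointE)
  have split: "(\<Sum>j\<le>k. f j) = f k + (\<Sum>j<k. f j)" for f :: seq and k
    by (simp add: lessThan_Suc_atMost[symmetric])
  have "((\<lambda>\<epsilon>. c \<epsilon> k) has_real_derivative z k) (at 0)" for k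
  proof (induction k rule: less_induct)
    case (less k)
    have c: "c \<epsilon> k = (m \<epsilon> k - (\<Sum>j<k. c \<epsilon> j * a k j (m \<epsilon>))) / w k" for \<epsilon>
      using M_rec[of "c \<epsilon>" k] w_nonzero[of k] by (simp add: Mc split a_diag)
    have z: "z k = (expansion v z k - (\<Sum>j<k. z j * a k j m0 + c0 j * da k j (expansion v z))) / w k"
      using expansion_rec[of z k] w_nonzero[of k] by (simp add: split[of _ k] a_diag da_diag)
    have s: "((\<lambda>\<epsilon>. \<Sum>j<k. c \<epsilon> j * a k j (m \<epsilon>)) has_real_derivative
        (\<Sum>j<k. z j * a k j m0 + c0 j * da k j (expansion v z))) (at 0)"
    proof (rule DERIV_sum)
      fix j assume j: "j \<in> {..<k}"
      then have "((\<lambda>\<epsilon>. a k j (m \<epsilon>)) has_real_derivative da k j (expansion v z)) (at 0)"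
        using m by (intro a_deriv) (auto simp: m0 has_curve_derivative_def)
      with less[of j] j show "((\<lambda>\<epsilon>. c \<epsilon> j * a k j (m \<epsilon>)) has_real_derivative
          z j * a k j m0 + c0 j * da k j (expansion v z)) (at 0)"
        by (auto intro!: derivative_eq_intros simp: c0 m0)
    qed
    have mk: "((\<lambda>\<epsilon>. m \<epsilon> k) has_real_derivative expansion v z k) (at 0)"
      using m by (simp add: has_curve_derivative_def)
    show ?case unfolding c z by (intro DERIV_cdivide DERIV_diff mk s)
  qed
  then show ?thesis by (simp add: has_curve_derivative_def c_def)
qed

text \<open>A line of moments becomes a curve of cumulants with tangent \<open>z\<close>, which is
  scaled linearly and mapped back. As \<open>c0\<close> is fixed by the scaling, the scaled curve
  again passes through \<open>c0\<close>, where the derivative of \<open>M\<close> is known.\<close>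

lemma gateaux_derivative_clt:
  "has_gateaux_derivative (M \<circ> cumulant_scaling \<circ> inv M) m0 y
     (expansion v (cumulant_scaling (inv (expansion v) y)))"
proof (rule has_gateaux_derivativeI)
  define z where "z = inv (expansion v) y"
  have y: "y = expansion v z" using bij_expansion by (simp add: z_def bij_is_surj surj_f_inv_f)
  define c where "c \<epsilon> = inv M (\<lambda>j. m0 j + \<epsilon> * y j)" for \<epsilon>
  have "has_curve_derivative (\<lambda>\<epsilon> j. m0 j + \<epsilon> * y j) y"
    by (auto simp: has_curve_derivative_def intro!: derivative_eq_intros)
  then have "has_curve_derivative c z"
    unfolding c_def y by (rule curve_derivative_cumulants) simp
  then have "has_curve_derivative (\<lambda>\<epsilon>. cumulant_scaling (c \<epsilon>)) (cumulant_scaling z)"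
    by (auto simp: has_curve_derivative_def cumulant_scaling_def intro: DERIV_cmult)
  moreover have "cumulant_scaling (c 0) = c0"
  proof -
    have "c 0 = inv M (M c0)" by (simp add: c_def M_c0)
    then show ?thesis using bij_M by (simp add: bij_is_inj c0_fixed)
  qed
  ultimately have "has_curve_derivative (\<lambda>\<epsilon>. M (cumulant_scaling (c \<epsilon>))) (expansion v (cumulant_scaling z))"
    by (rule curve_derivative_moments)
  then show "has_curve_derivative (\<lambda>\<epsilon>. (M \<circ> cumulant_scaling \<circ> inv M) (\<lambda>j. m0 j + \<epsilon> * y j))
      (expansion v (cumulant_scaling (inv (expansion v) y)))"
    by (simp add: c_def z_def)
qed

text \<open>In the coordinates \<open>z\<close> given by \<open>expansion v\<close> the operator is
  diagonal with distinct entries, so its eigenvectors are the nonzero multiples of unit vectors, and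
  \<open>expansion v\<close> sends the \<open>n\<close>-th unit vector to
  \<open>v n\<close>.\<close>

lemma eigenvector_iff:
  assumes L: "\<And>y. L y = expansion v (cumulant_scaling (inv (expansion v) y))"
  shows "eigenvector L l y \<longleftrightarrow>
    (\<exists>n b. l = 2 powr (1 - real (Suc n) / 2) \<and> b \<noteq> 0 \<and> y = (\<lambda>k. b * v n k))"
proof -
  have single: "expansion v (\<lambda>k. if k = n then b else 0) = (\<lambda>k. b * v n k)" for n b
  proof
    fix k
    have "expansion v (\<lambda>k. if k = n then b else 0) k = (\<Sum>i\<le>k. if i = n then b * v i k else 0)"
      unfolding expansion_def by (intro sum.cong) auto
    then show "expansion v (\<lambda>k. if k = n then b else 0) k = b * v n k" by (simp add: v_lower)
  qed
  have scale: "expansion v (\<lambda>k. l * z k) = (\<lambda>k. l * expansion v z k)" for l z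
    by (simp add: expansion_def sum_distrib_left mult_ac)
  have inj: "expansion v z = expansion v z' \<longleftrightarrow> z = z'" for z z'
    using bij_expansion by (simp add: bij_is_inj inj_eq)
  have zero: "expansion v (\<lambda>k. 0) = (\<lambda>k. 0)" by (simp add: expansion_def)
  define z where "z = inv (expansion v) y"
  have y: "y = expansion v z" using bij_expansion by (simp add: z_def bij_is_surj surj_f_inv_f)
  have "eigenvector L l y \<longleftrightarrow> z \<noteq> (\<lambda>k. 0) \<and> cumulant_scaling z = (\<lambda>k. l * z k)"
  proof -
    have "y \<noteq> (\<lambda>k. 0) \<longleftrightarrow> z \<noteq> (\<lambda>k. 0)" using inj[of z "\<lambda>k. 0"] by (simp add: y zero)
    moreover have "L y = expansion v (cumulant_scaling z)" by (simp add: L z_def)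
    moreover have "(\<lambda>k. l * y k) = expansion v (\<lambda>k. l * z k)" by (subst y) (rule scale[symmetric])
    moreover note inj[of "cumulant_scaling z" "\<lambda>k. l * z k"]
    ultimately show ?thesis by (simp add: eigenvector_def)
  qed
  also have "\<dots> \<longleftrightarrow> (\<exists>n b. l = 2 powr (1 - real (Suc n) / 2) \<and> b \<noteq> 0 \<and> z = (\<lambda>k. if k = n then b else 0))"
    (is "?l \<longleftrightarrow> ?r")
  proof
    assume ?l
    then obtain n where n: "z n \<noteq> 0" by auto
    have eq: "2 powr (1 - real (Suc k) / 2) * z k = l * z k" for k
      using \<open>?l\<close> by (simp add: cumulant_scaling_def fun_eq_iff)
    then have l: "l = 2 powr (1 - real (Suc n) / 2)" using n by (metis mult_right_cancel)
    have "z k = 0" if "k \<noteq> n" for k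
      using eq[of k] eigenvalue_inj[of k n] that unfolding l by (metis mult_right_cancel)
    then show ?r using l n by (intro exI[of _ n] exI[of _ "z n"]) auto
  next
    assume ?r
    then show ?l by (auto simp: cumulant_scaling_def fun_eq_iff)
  qed
  also have "\<dots> \<longleftrightarrow> (\<exists>n b. l = 2 powr (1 - real (Suc n) / 2) \<and> b \<noteq> 0 \<and> y = (\<lambda>k. b * v n k))"
    unfolding y single[symmetric] inj ..
  finally show ?thesis .
qed

text \<open>Reduces each case to moment integrals: \<open>\<kappa> n\<close> is the factor between
  the moments of \<open>f (Suc n)\<close> and \<open>v n\<close>. The shift arises because
  \<open>v\<close> counts from 0 and the densities from 1.\<close>

lemma clt_spectrum:
  assumes f: "\<And>n. n \<ge> 1 \<Longrightarrow> f n \<in> borel_measurable borel"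
    and int: "\<And>n k. n \<ge> 1 \<Longrightarrow> integrable lborel (\<lambda>x. x ^ k * f n x)"
    and mass: "\<And>n. n \<ge> 1 \<Longrightarrow> (\<integral>x. f n x \<partial>lborel) = 0"
    and mom: "\<And>n k. (\<integral>x. x ^ Suc k * f (Suc n) x \<partial>lborel) = \<kappa> n * v n k" and \<kappa>: "\<And>n. \<kappa> n \<noteq> 0"
  defines "T \<equiv> M \<circ> cumulant_scaling \<circ> inv M"
  defines "L \<equiv> gateaux_derivative T m0"
  shows "(\<forall>y. has_gateaux_derivative T m0 y (L y)) \<and>
    {l. \<exists>y. eigenvector L l y} = {2 powr (1 - real n / 2) |n. n \<ge> 1} \<and>
    (\<forall>n\<ge>1. eigenfunctions_have_density L (2 powr (1 - real n / 2)) (f n))"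
proof (intro conjI allI impI)
  have L: "L y = expansion v (cumulant_scaling (inv (expansion v) y))" for y
    unfolding L_def T_def by (rule gateaux_derivative_eq[OF gateaux_derivative_clt])
  note eig = eigenvector_iff[of L, OF L]
  show "has_gateaux_derivative T m0 y (L y)" for y
    unfolding L T_def by (rule gateaux_derivative_clt)
  have "(\<exists>y. eigenvector L l y) \<longleftrightarrow> (\<exists>n\<ge>1. l = 2 powr (1 - real n / 2))" for l
  proof
    assume "\<exists>y. eigenvector L l y"
    then obtain n where "l = 2 powr (1 - real (Suc n) / 2)" unfolding eig by blast
    then show "\<exists>n\<ge>1. l = 2 powr (1 - real n / 2)" by (intro exI[of _ "Suc n"]) simp
  next
    assume "\<exists>n\<ge>1. l = 2 powr (1 - real n / 2)"
    then obtain n where "l = 2 powr (1 - real (Suc n) / 2)" by (metis One_nat_def Suc_le_D)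
    then have "eigenvector L l (\<lambda>k. 1 * v n k)" unfolding eig by (metis zero_neq_one)
    then show "\<exists>y. eigenvector L l y" by blast
  qed
  then show "{l. \<exists>y. eigenvector L l y} = {2 powr (1 - real n / 2) |n. n \<ge> 1}" by auto
  fix n :: nat assume "n \<ge> 1"
  then obtain n' where n': "n = Suc n'" by (metis One_nat_def Suc_le_D)
  have fm: "(\<lambda>x. a * f n x) \<in> borel_measurable borel" for a
    using f[OF \<open>n \<ge> 1\<close>] by simp
  have fi: "integrable lborel (\<lambda>x. x ^ k * (a * f n x))" for a k
    using integrable_mult_right[OF int[OF \<open>n \<ge> 1\<close>], of a k] by (simp add: mult_ac)
  have ms: "signed_moment_seq (signed_density (\<lambda>x. a * f n x)) = (\<lambda>i. a * \<kappa> n' * v n' i)" for a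
  proof -
    have "(\<integral>x. x ^ Suc i * (a * f n x) \<partial>lborel) = a * \<kappa> n' * v n' i" for i
      using mom[of i n'] integral_mult_right_zero[of lborel a "\<lambda>x. x ^ Suc i * f n x"]
      by (simp add: n' mult_ac)
    then show ?thesis by (simp add: signed_density_moments(3)[OF fm fi])
  qed
  have "{y. eigenvector L (2 powr (1 - real n / 2)) y} = {(\<lambda>k. b * v n' k) |b. b \<noteq> 0}"
    unfolding eig n' eigenvalue_inj by auto
  also have "\<dots> = {(\<lambda>i. a * \<kappa> n' * v n' i) |a. a \<noteq> 0}"
  proof safe
    fix b :: real assume "b \<noteq> 0"
    then show "\<exists>a. (\<lambda>k. b * v n' k) = (\<lambda>i. a * \<kappa> n' * v n' i) \<and> a \<noteq> 0"
      using \<kappa>[of n'] by (intro exI[of _ "b / \<kappa> n'"]) simp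
  next
    fix a :: real assume "a \<noteq> 0"
    then show "\<exists>b. (\<lambda>i. a * \<kappa> n' * v n' i) = (\<lambda>k. b * v n' k) \<and> b \<noteq> 0"
      using \<kappa>[of n'] by (intro exI[of _ "a * \<kappa> n'"]) simp
  qed
  finally show "eigenfunctions_have_density L (2 powr (1 - real n / 2)) (f n)"
    unfolding eigenfunctions_have_density_def ms
    using f mass \<open>n \<ge> 1\<close> signed_density_moments(1,2)[OF fm fi] by simp
qed

end

section \<open>The Gaussian law\<close>

text \<open>Index 1 is order 2, where the scaling factor is 1. The same sequence serves both laws,
  since \<open>fact 1 = 1\<close> makes the two normalisations agree at this order.\<close>

definition second_cumulant_one :: seq where
  "second_cumulant_one = (\<lambda>i. if i = 1 then 1 else 0)"

lemma cumulant_scaling_second: "cumulant_scaling second_cumulant_one = second_cumulant_one"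
  by (auto simp: cumulant_scaling_def second_cumulant_one_def fun_eq_iff)

lemma sum_second_cumulant:
  "(\<Sum>j\<le>k. second_cumulant_one j * g j) = (if k = 0 then 0 else g 1)"
proof -
  have "(\<Sum>j\<le>k. second_cumulant_one j * g j) = (\<Sum>j\<le>k. if j = 1 then g j else 0)"
    by (intro sum.cong) (auto simp: second_cumulant_one_def)
  then show ?thesis by simp
qed

text \<open>The counterpart of \<^const>\<open>with_unit\<close> for tangent vectors, whose total mass is 0.\<close>

definition with_zero :: "seq \<Rightarrow> seq" where
  "with_zero m k = (case k of 0 \<Rightarrow> 0 | Suc i \<Rightarrow> m i)"

lemma with_zero_simps [simp]: "with_zero m 0 = 0" "with_zero m (Suc i) = m i"
  by (auto simp: with_zero_def)

lemma with_zero_sum: "with_zero (\<lambda>i. \<Sum>n\<in>N. s n * Y n i) k = (\<Sum>n\<in>N. s n * with_zero (Y n) k)"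
  by (cases k) auto

lemma with_zero_cong: "(\<And>i. i < l \<Longrightarrow> y i = z i) \<Longrightarrow> k \<le> l \<Longrightarrow> with_zero y k = with_zero z k"
  by (cases k) auto

lemma with_unit_deriv:
  assumes "\<And>i. i < l \<Longrightarrow> ((\<lambda>\<epsilon>. x \<epsilon> i) has_real_derivative z i) (at 0)" "k \<le> l"
  shows "((\<lambda>\<epsilon>. with_unit (x \<epsilon>) k) has_real_derivative with_zero z k) (at 0)"
  using assms by (cases k) auto

section \<open>Polynomials under the Gaussian weight\<close>

definition gauss_mean :: "real poly \<Rightarrow> real" where
  "gauss_mean p = (\<integral>x. std_normal_density x * poly p x \<partial>lborel)"

lemma integrable_gauss_poly: "integrable lborel (\<lambda>x. std_normal_density x * poly p x)"
proof -
  have "integrable lborel (\<lambda>x. \<Sum>i\<le>degree p. coeff p i * (std_normal_density x * x ^ i))"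
    by (intro Bochner_Integration.integrable_sum integrable_mult_right integrable_std_normal_moment)
  then show ?thesis by (simp add: poly_altdef sum_distrib_left mult_ac)
qed

lemma gauss_mean_add: "gauss_mean (p + q) = gauss_mean p + gauss_mean q"
  using Bochner_Integration.integral_add[OF integrable_gauss_poly[of p] integrable_gauss_poly[of q]]
  by (simp add: gauss_mean_def distrib_left)

lemma gauss_mean_smult: "gauss_mean (smult a p) = a * gauss_mean p"
  using integral_mult_right_zero[of lborel a "\<lambda>x. std_normal_density x * poly p x"]
  by (simp add: gauss_mean_def mult_ac)

lemma gauss_mean_diff: "gauss_mean (p - q) = gauss_mean p - gauss_mean q"
  using gauss_mean_add[of p "smult (-1) q"] by (simp add: gauss_mean_smult[of "-1" q, simplified])

lemma gauss_mean_odd: "odd k \<Longrightarrow> gauss_mean (monom 1 k) = 0"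
  using integral_std_normal_moment_odd by (auto simp: gauss_mean_def poly_monom elim!: oddE)

lemma gauss_mean_even: "gauss_mean (monom 1 (2 * k)) = fact (2 * k) / (2 ^ k * fact k)"
  using integral_std_normal_moment_even by (simp add: gauss_mean_def poly_monom)

text \<open>Integration by parts for monomials, read off from the closed form of the even moments.
  At \<open>k = 0\<close> the truncated \<open>k - 1\<close> is harmless because of the factor
  \<open>real k\<close>.\<close>

lemma gauss_mean_monom_Suc: "gauss_mean (monom 1 (Suc k)) = real k * gauss_mean (monom 1 (k - 1))"
proof (cases "even k")
  case True
  then show ?thesis by (cases "k = 0") (simp_all add: gauss_mean_odd)
next
  case False
  then obtain j where k: "k = 2 * j + 1" by (elim oddE)
  have "gauss_mean (monom 1 (2 * Suc j)) = real (2 * j + 1) * gauss_mean (monom 1 (2 * j))"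
  proof -
    have "(fact (2 * Suc j) :: real) = real (2 * Suc j) * (real (2 * j + 1) * fact (2 * j))" by simp
    moreover have "2 ^ Suc j * (fact (Suc j) :: real) = real (2 * Suc j) * (2 ^ j * fact j)" by simp
    ultimately show ?thesis unfolding gauss_mean_even
        by (simp only: mult_divide_mult_cancel_left_if) simp
  qed
  then show ?thesis by (simp add: k)
qed

text \<open>Gaussian integration by parts (Stein's identity), extended linearly from
  monomials.\<close>

lemma gauss_mean_pderiv: "gauss_mean (pderiv p) = gauss_mean ([:0, 1:] * p)"
proof -
  \<comment> \<open>The extra factor \<open>monom 1 k\<close> carries the induction over the
    coefficients of \<open>p\<close>: removing the lowest one raises \<open>k\<close> by 1.\<close>
  have "gauss_mean (pderiv (monom 1 k * p)) = gauss_mean ([:0, 1:] * (monom 1 k * p))" for k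
  proof (induction p arbitrary: k)
    case (pCons a p)
    have s: "monom 1 k * pCons a p = smult a (monom 1 k) + monom 1 (Suc k) * p"
      by (rule poly_eqI) (simp add: coeff_monom_mult coeff_pCons split: nat.split)
    have "pderiv (monom 1 k :: real poly) = smult (real k) (monom 1 (k - 1))"
      by (simp add: pderiv_monom smult_monom)
    then have "gauss_mean (pderiv (monom 1 k)) = gauss_mean ([:0, 1:] * monom 1 k)"
      using gauss_mean_monom_Suc[of k] by (simp add: gauss_mean_smult monom_Suc)
    then show ?case
      unfolding s pderiv_add pderiv_smult distrib_left mult_smult_right gauss_mean_add gauss_mean_smult
      using pCons.IH[of "Suc k"] by simp
  qed simp
  from this[of 0] show ?thesis by simp
qed

text \<open>Follows by differentiating the three-term recurrence. It turns that recurrence into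
  \<open>hermite_poly_Suc\<close>, the form produced by differentiating a Hermite polynomial times
  the Gaussian.\<close>

lemma pderiv_hermite_poly: "pderiv (hermite_poly (Suc n)) = smult (real (Suc n)) (hermite_poly n)"
proof (induction n rule: hermite_poly.induct)
  case (3 n)
  let ?H = hermite_poly
  have H: "[:0, 1:] * ?H (Suc n) - smult (real (Suc n)) (?H n) = ?H (Suc (Suc n))"
    by (simp only: hermite_poly.simps)
  have "pderiv (?H (Suc (Suc (Suc n)))) =
      pderiv ([:0, 1:] * ?H (Suc (Suc n)) - smult (real (Suc (Suc n))) (?H (Suc n)))"
    by (simp only: hermite_poly.simps)
  also have "\<dots> = ?H (Suc (Suc n)) + [:0, 1:] * pderiv (?H (Suc (Suc n))) -
      smult (real (Suc (Suc n))) (pderiv (?H (Suc n)))"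
    by (simp add: pderiv_diff pderiv_mult pderiv_smult pderiv_pCons del: hermite_poly.simps(3))
  also have "\<dots> = ?H (Suc (Suc n)) +
      smult (real (Suc (Suc n))) ([:0, 1:] * ?H (Suc n) - smult (real (Suc n)) (?H n))"
    by (simp only: 3 mult_smult_right smult_diff_right add_diff_eq)
  also have "\<dots> = smult (1 + real (Suc (Suc n))) (?H (Suc (Suc n)))"
    by (simp only: H smult_add_left smult_1_left)
  finally show ?case by simp
qed (simp_all add: pderiv_pCons)

lemma hermite_poly_Suc: "hermite_poly (Suc n) = [:0, 1:] * hermite_poly n - pderiv (hermite_poly n)"
proof (cases n)
  case 0
  then show ?thesis by simp
next
  case (Suc m)
  then show ?thesis by (simp only: pderiv_hermite_poly hermite_poly.simps)
qed

lemma deriv_gauss: "(deriv ^^ n) (\<lambda>u. exp (- u\<^sup>2 / 2)) = (\<lambda>x::real. (-1) ^ n * poly (hermite_poly n) x * exp (- x\<^sup>2 / 2))"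
proof (induction n)
  case (Suc n)
  have "((\<lambda>x. (-1) ^ n * poly (hermite_poly n) x * exp (- x\<^sup>2 / 2)) has_real_derivative
      (-1) ^ Suc n * poly (hermite_poly (Suc n)) x * exp (- x\<^sup>2 / 2)) (at x)" for x :: real
    unfolding hermite_poly_Suc
    by (auto intro!: derivative_eq_intros simp: algebra_simps)
  from DERIV_imp_deriv[OF this] show ?case by (simp only: funpow.simps o_apply Suc)
qed simp

section \<open>Moments of Hermite polynomials\<close>

definition hermite_moment :: "nat \<Rightarrow> nat \<Rightarrow> real" where
  "hermite_moment n k = gauss_mean (monom 1 k * hermite_poly n)"

text \<open>Integration by parts trades one Hermite index for a derivative of the monomial.\<close>

lemma hermite_moment_Suc: "hermite_moment (Suc n) k = real k * hermite_moment n (k - 1)"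
proof -
  have "pderiv (monom 1 k :: real poly) = smult (real k) (monom 1 (k - 1))"
    by (simp add: pderiv_monom smult_monom)
  then have "pderiv (monom 1 k * hermite_poly n) = monom 1 k * pderiv (hermite_poly n) +
      smult (real k) (monom 1 (k - 1) * hermite_poly n)"
    by (simp only: pderiv_mult mult_smult_right mult.commute[of "hermite_poly n"])
  then have "gauss_mean (pderiv (monom 1 k * hermite_poly n)) =
      gauss_mean (monom 1 k * pderiv (hermite_poly n)) + real k * hermite_moment n (k - 1)"
    by (simp add: gauss_mean_add gauss_mean_smult hermite_moment_def)
  moreover have "monom 1 k * hermite_poly (Suc n) =
      [:0, 1:] * (monom 1 k * hermite_poly n) - monom 1 k * pderiv (hermite_poly n)"
    unfolding hermite_poly_Suc right_diff_distrib by (simp only: mult.left_commute)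
  ultimately show ?thesis
    by (simp only: hermite_moment_def gauss_mean_diff gauss_mean_pderiv)
qed

text \<open>Comes from the three-term recurrence followed by one integration by parts; divided by
  \<open>real (Suc n)\<close> it is the assumption \<open>v_rec\<close> in the Gaussian
  case.\<close>

lemma hermite_moment_rec:
  "hermite_moment (Suc n) (Suc k) = real k * hermite_moment (Suc n) (k - 1) + real (Suc n) * hermite_moment n k"
proof -
  have "monom 1 (Suc k) * hermite_poly (Suc n) =
      monom 1 k * hermite_poly (Suc (Suc n)) + smult (real (Suc n)) (monom 1 k * hermite_poly n)"
    by (simp add: monom_Suc algebra_simps)
  then have "hermite_moment (Suc n) (Suc k) = hermite_moment (Suc (Suc n)) k + real (Suc n) * hermite_moment n k"
    by (simp only: hermite_moment_def gauss_mean_add gauss_mean_smult)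
  then show ?thesis by (simp only: hermite_moment_Suc[of "Suc n" k])
qed

text \<open>Iterates \<open>hermite_moment_Suc\<close>. The right-hand side is the coefficient of
  the \<open>n\<close>-th cumulant in \<open>classical_moments_rec\<close> at the Gaussian moments,
  and it is 0 for \<open>k < n\<close>.\<close>

lemma hermite_moment_eq: "hermite_moment n k = fact n * real (k choose n) * hermite_moment 0 (k - n)"
proof (induction n arbitrary: k)
  case (Suc n)
  show ?case
  proof (cases k)
    case (Suc j)
    have "real (Suc j) * real (j choose n) = real (Suc n) * real (Suc j choose Suc n)"
      by (simp only: of_nat_mult[symmetric] Suc_times_binomial)
    then show ?thesis by (simp add: hermite_moment_Suc Suc.IH Suc del: binomial_Suc_Suc of_nat_Suc)
  qed (simp add: hermite_moment_Suc)
qed simp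

lemma hermite_moment_0:
  "hermite_moment 0 0 = 1" "hermite_moment 0 (Suc k) = real k * hermite_moment 0 (k - 1)"
  using gauss_mean_even[of 0] gauss_mean_monom_Suc[of k] by (simp_all add: hermite_moment_def)

lemma with_unit_gaussian: "with_unit (moment_seq gaussian) k = hermite_moment 0 k"
proof (cases k)
  case (Suc i)
  have "moment gaussian k = (\<integral>x. std_normal_density x * x ^ k \<partial>lborel)"
    unfolding moment_def gaussian_def by (subst integral_density) auto
  then show ?thesis using Suc by (simp add: moment_seq_def hermite_moment_def gauss_mean_def poly_monom)
qed (simp add: hermite_moment_0)

text \<open>With only the second cumulant present, the moment recursion reduces to the Gaussian
  recurrence \<open>u (Suc i) = real i * u (i - 1)\<close>.\<close>

lemma classical_moments_gaussian: "classical_moments second_cumulant_one = moment_seq gaussian"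
proof -
  let ?u = "with_unit (classical_moments second_cumulant_one)"
  have "?u k = hermite_moment 0 k" for k
  proof (induction k rule: less_induct)
    case (less k)
    show ?case
    proof (cases k)
      case (Suc i)
      have "?u k = (if i = 0 then 0 else fact 1 * real (i choose 1) * ?u (i - 1))"
        unfolding Suc with_unit_simps(2) by (subst classical_moments_rec) (rule sum_second_cumulant)
      also have "\<dots> = real i * hermite_moment 0 (i - 1)" using less[of "i - 1"] Suc by simp
      finally show ?thesis by (simp add: Suc hermite_moment_0)
    qed (simp add: hermite_moment_0)
  qed
  then have "classical_moments second_cumulant_one i = moment_seq gaussian i" for i
    using with_unit_gaussian[of "Suc i"] by (metis with_unit_simps(2))
  then show ?thesis by blast
qed

text \<open>Dividing by \<open>real (Suc n)\<close> gives \<open>v n n = fact n\<close>, the weight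
  of the normalised cumulant at index \<open>n\<close>.\<close>

interpretation classical: triangular_moments classical_moments
  "\<lambda>k j m. fact j * real (k choose j) * with_unit m (k - j)"
  "\<lambda>k j z. fact j * real (k choose j) * with_zero z (k - j)"
  fact second_cumulant_one "moment_seq gaussian"
  "\<lambda>n k. hermite_moment (Suc n) (Suc k) / real (Suc n)"
proof
  show "classical_moments c k = (\<Sum>j\<le>k. c j * (fact j * real (k choose j) * with_unit (classical_moments c) (k - j)))" for c k
    by (rule classical_moments_rec)
  show "((\<lambda>\<epsilon>. fact j * real (k choose j) * with_unit (x \<epsilon>) (k - j)) has_real_derivative
      fact j * real (k choose j) * with_zero z (k - j)) (at 0)"
    if "\<And>i. i < k \<Longrightarrow> ((\<lambda>\<epsilon>. x \<epsilon> i) has_real_derivative z i) (at 0)" for j k x z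
    by (intro DERIV_cmult with_unit_deriv[of k] that) auto
  show "fact j * real (k choose j) * with_zero y (k - j) = fact j * real (k choose j) * with_zero z (k - j)"
    if "\<And>i. i < k \<Longrightarrow> y i = z i" for j k y z
    using with_zero_cong[of k y z "k - j"] that by simp
  show "hermite_moment (Suc n) (Suc k) / real (Suc n) = 0" if "k < n" for k n
    using that by (simp add: hermite_moment_eq[of "Suc n"] binomial_eq_0)
  show "hermite_moment (Suc n) (Suc k) / real (Suc n) =
      fact n * real (k choose n) * with_unit (moment_seq gaussian) (k - n) +
      (\<Sum>j\<le>k. second_cumulant_one j *
         (fact j * real (k choose j) * with_zero (\<lambda>k. hermite_moment (Suc n) (Suc k) / real (Suc n)) (k - j)))"
    for n k
  proof -
    \<comment> \<open>At order 0 both sides vanish, as the Hermite densities of positive degree have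
      total mass 0.\<close>
    have z: "with_zero (\<lambda>k. hermite_moment (Suc n) (Suc k) / real (Suc n)) i = hermite_moment (Suc n) i / real (Suc n)" for i
      by (cases i) (simp_all add: hermite_moment_Suc)
    show ?thesis
      unfolding sum_second_cumulant z with_unit_gaussian hermite_moment_eq[of n k, symmetric]
      unfolding hermite_moment_rec[of n k]
      by (cases "k = 0") (simp_all add: add_divide_distrib del: of_nat_Suc)
  qed
qed (auto simp: bij_classical_moments with_zero_sum sum_distrib_left mult_ac classical_moments_gaussian
    cumulant_scaling_second)

section \<open>The spectrum in the classical case\<close>

lemma gauss_deriv_density:
  "x ^ k * (deriv ^^ n) (\<lambda>u. exp (- u\<^sup>2 / 2)) (x::real) =
    (-1) ^ n * sqrt (2 * pi) * (std_normal_density x * poly (monom 1 k * hermite_poly n) x)"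
  by (simp only: deriv_gauss) (simp add: std_normal_density_def poly_monom)

lemma gauss_deriv_moment:
  "integrable lborel (\<lambda>x::real. x ^ k * (deriv ^^ n) (\<lambda>u. exp (- u\<^sup>2 / 2)) x)"
  "(\<integral>x. x ^ k * (deriv ^^ n) (\<lambda>u. exp (- u\<^sup>2 / 2)) x \<partial>lborel) = (-1) ^ n * sqrt (2 * pi) * hermite_moment n k"
  unfolding gauss_deriv_density integral_mult_right_zero
  by (auto simp only: hermite_moment_def gauss_mean_def intro!: integrable_mult_right integrable_gauss_poly)

lemma classical_spectrum:
  defines "L \<equiv> gateaux_derivative classical_clt (moment_seq gaussian)"
  shows "(\<forall>y. has_gateaux_derivative classical_clt (moment_seq gaussian) y (L y)) \<and>
    {l. \<exists>y. eigenvector L l y} = {2 powr (1 - real n / 2) |n. n \<ge> 1} \<and>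
    (\<forall>n\<ge>1. eigenfunctions_have_density L (2 powr (1 - real n / 2)) ((deriv ^^ n) (\<lambda>x. exp (- x\<^sup>2 / 2))))"
  unfolding L_def classical_clt_def classical_cumulants_def
\<comment> \<open>The sign comes from the \<open>Suc n\<close> differentiations,
  \<open>sqrt (2 * pi)\<close> from normalising the density, and \<open>real (Suc n)\<close> undoes
  the division in \<open>v\<close>.\<close>
proof (rule classical.clt_spectrum[where \<kappa> = "\<lambda>n. (-1) ^ Suc n * sqrt (2 * pi) * real (Suc n)"])
  fix n k :: nat
  show "(deriv ^^ n) (\<lambda>x::real. exp (- x\<^sup>2 / 2)) \<in> borel_measurable borel"
    unfolding deriv_gauss by (intro borel_measurable_continuous_onI continuous_intros) simp
  show "integrable lborel (\<lambda>x::real. x ^ k * (deriv ^^ n) (\<lambda>x. exp (- x\<^sup>2 / 2)) x)"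
    by (rule gauss_deriv_moment)
  show "(\<integral>x. (deriv ^^ n) (\<lambda>x::real. exp (- x\<^sup>2 / 2)) x \<partial>lborel) = 0" if "1 \<le> n"
    using that gauss_deriv_moment(2)[of 0 n]
        by (cases n) (simp_all add: hermite_moment_Suc del: funpow.simps)
  show "(\<integral>x. x ^ Suc k * (deriv ^^ Suc n) (\<lambda>x. exp (- x\<^sup>2 / 2)) x \<partial>lborel) =
      (-1) ^ Suc n * sqrt (2 * pi) * real (Suc n) * (hermite_moment (Suc n) (Suc k) / real (Suc n))"
    unfolding gauss_deriv_moment by simp
qed simp

section \<open>The semicircle law\<close>

text \<open>At the endpoints the value is 0, because \<open>1 / 0 = 0\<close>.\<close>

definition arcsine_weight :: "real \<Rightarrow> real" where
  "arcsine_weight t = indicator {-2..2} t * (1 / sqrt (4 - t\<^sup>2))"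

definition cheb_moment :: "nat \<Rightarrow> nat \<Rightarrow> real" where
  "cheb_moment n k = (\<integral>t. t ^ k * (arcsine_weight t * poly (cheb_poly n) (t / 2)) \<partial>lborel)"

lemma arcsine_weight_measurable [measurable]: "arcsine_weight \<in> borel_measurable borel"
  unfolding arcsine_weight_def[abs_def] by measurable

text \<open>Passes to the open interval, where the antiderivatives built from \<open>arccos\<close>
  are differentiable; the endpoint values 0 make this a pointwise identity.\<close>

lemma arcsine_weight_eq: "arcsine_weight t = indicator (einterval (-2) 2) t * (1 / sqrt (4 - t\<^sup>2))"
proof -
  have "t \<in> {-2..2} \<longleftrightarrow> t \<in> einterval (-2) 2 \<or> t = 2 \<or> t = -2"
    by (auto simp: einterval_iff)
  then show ?thesis by (auto simp: arcsine_weight_def indicator_def)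
qed

section \<open>Integrals against the arcsine weight\<close>

lemma square_le_4: "-2 \<le> x \<Longrightarrow> x \<le> 2 \<Longrightarrow> (x::real)\<^sup>2 \<le> 4"
  using abs_le_square_iff[of x 2] by (simp add: abs_le_iff)

lemma square_less_4: "-2 < x \<Longrightarrow> x < 2 \<Longrightarrow> (x::real)\<^sup>2 < 4"
  using abs_square_less_1[of "x / 2"] by (simp add: power_divide abs_less_iff)

lemma einterval_2_iff: "x \<in> einterval (-2) 2 \<longleftrightarrow> -2 < x \<and> x < 2"
  by (auto simp: einterval_iff)

lemma deriv_arccos_half:
  assumes "-2 < x" "x < 2"
  shows "((\<lambda>x. arccos (x / 2)) has_real_derivative - (1 / sqrt (4 - x\<^sup>2))) (at x)"
proof -
  have "sqrt (4 - x\<^sup>2) = sqrt (2\<^sup>2 * (1 - (x / 2)\<^sup>2))" by (simp add: power_divide)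
  also have "\<dots> = 2 * sqrt (1 - (x / 2)\<^sup>2)" by (simp only: real_sqrt_mult real_sqrt_abs)
  finally have s: "sqrt (4 - x\<^sup>2) = 2 * sqrt (1 - (x / 2)\<^sup>2)" .
  have "((\<lambda>x. arccos (x / 2)) has_real_derivative inverse (- sqrt (1 - (x / 2)\<^sup>2)) * (1 / 2)) (at x)"
    using assms by (intro DERIV_chain2[OF DERIV_arccos]) (auto intro!: derivative_eq_intros)
  then show ?thesis unfolding s by (simp add: field_simps)
qed

lemma arcsine_isCont: "-2 < x \<Longrightarrow> x < 2 \<Longrightarrow> isCont (\<lambda>t. 1 / sqrt (4 - t\<^sup>2)) x"
  using square_less_4[of x] by (intro continuous_intros) auto

text \<open>Supplies boundary limits in the extended-real form required by the fundamental theorem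
  for interval integrals.\<close>

lemma tendsto_real_of_ereal_ends:
  fixes g :: "real \<Rightarrow> real"
  assumes "continuous_on {-2..2} g"
  shows "((g \<circ> real_of_ereal) \<longlongrightarrow> g (-2)) (at_right (-2))" "((g \<circ> real_of_ereal) \<longlongrightarrow> g 2) (at_left 2)"
proof -
  have "(g \<longlongrightarrow> g (-2)) (at_right (-2))" "(g \<longlongrightarrow> g 2) (at_left 2)"
    using assms by (auto simp: continuous_on_Icc_at_rightD continuous_on_Icc_at_leftD)
  then show "((g \<circ> real_of_ereal) \<longlongrightarrow> g (-2)) (at_right (-2))" "((g \<circ> real_of_ereal) \<longlongrightarrow> g 2) (at_left 2)"
    using ereal_tendsto_simps1(2)[of g "g (-2)" "-2"] ereal_tendsto_simps1(1)[of g "g 2" 2] by simp_all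
qed

lemma cont_arccos_half: "continuous_on {-2..2} (\<lambda>x::real. arccos (x / 2))"
  by (rule continuous_on_arccos) (auto intro!: continuous_intros)

text \<open>The antiderivative \<open>- arccos (x / 2)\<close> runs from \<open>- pi\<close> to 0;
  nonnegativity of the weight gives integrability despite the endpoint singularities.\<close>

lemma arcsine_integrable: "integrable lborel arcsine_weight" "(\<integral>t. arcsine_weight t \<partial>lborel) = pi"
proof -
  have c: "continuous_on {-2..2} (\<lambda>x::real. - arccos (x / 2))"
    by (intro continuous_on_minus cont_arccos_half)
  have d: "DERIV (\<lambda>x. - arccos (x / 2)) x :> 1 / sqrt (4 - x\<^sup>2)" if "-2 < ereal x" "ereal x < 2" for x
    using DERIV_minus[OF deriv_arccos_half[of x]] that by simp
  have ct: "isCont (\<lambda>t. 1 / sqrt (4 - t\<^sup>2)) x" if "-2 < ereal x" "ereal x < 2" for x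
    using arcsine_isCont that by simp
  have nn: "AE x in lborel. -2 < ereal x \<longrightarrow> ereal x < 2 \<longrightarrow> 0 \<le> 1 / sqrt (4 - x\<^sup>2)"
    using square_less_4 by (intro AE_I2) (auto intro: less_imp_le)
  have "(-2::ereal) < 2" by simp
  note * = interval_integral_FTC_nonneg[OF this d ct nn tendsto_real_of_ereal_ends[OF c]]
  have w: "arcsine_weight = (\<lambda>t. indicator (einterval (-2) 2) t *\<^sub>R (1 / sqrt (4 - t\<^sup>2)))"
    by (simp add: fun_eq_iff arcsine_weight_eq)
  show "integrable lborel arcsine_weight" using *(1) by (simp add: set_integrable_def w)
  show "(\<integral>t. arcsine_weight t \<partial>lborel) = pi"
    using *(2) by (simp add: interval_lebesgue_integral_def set_lebesgue_integral_def w)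
qed

lemma integrable_arcsine_mult:
  fixes g :: "real \<Rightarrow> real"
  assumes g: "continuous_on UNIV g"
  shows "integrable lborel (\<lambda>t. arcsine_weight t * g t)"
proof -
  have "compact (g ` {-2..2})" using g
      by (intro compact_continuous_image) (auto intro: continuous_on_subset)
  then obtain K where K: "\<bar>g t\<bar> \<le> K" if "t \<in> {-2..2}" for t
    using compact_imp_bounded by (force simp: bounded_iff)
  have [measurable]: "g \<in> borel_measurable borel" using g by (rule borel_measurable_continuous_onI)
  have "norm (arcsine_weight t * g t) \<le> norm (arcsine_weight t * K)" for t
  proof (cases "t \<in> {-2..2}")
    case True
    then have "\<bar>g t\<bar> \<le> \<bar>K\<bar>" using K[OF True] by simp
    then show ?thesis by (auto simp: abs_mult intro: mult_left_mono)
  qed (simp add: arcsine_weight_def)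
  then show ?thesis
    by (intro Bochner_Integration.integrable_bound[OF integrable_mult_left[OF arcsine_integrable(1), of K]]) auto
qed

lemma integrable_cheb: "integrable lborel (\<lambda>t. t ^ k * (arcsine_weight t * poly (cheb_poly n) (t / 2)))"
proof -
  have "integrable lborel (\<lambda>t. arcsine_weight t * (t ^ k * poly (cheb_poly n) (t / 2)))"
    by (intro integrable_arcsine_mult continuous_intros) simp
  then show ?thesis by (simp add: mult_ac)
qed

text \<open>For \<open>n > 0\<close>, writing \<open>x = 2 * cos \<theta>\<close> turns the
  integrand into a cosine, with antiderivative \<open>- sin (n * arccos (x / 2)) / n\<close>, which
  vanishes at both endpoints.\<close>

lemma cheb_moment_0: "cheb_moment n 0 = (if n = 0 then pi else 0)"
proof (cases "n = 0")
  case False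
  let ?F = "\<lambda>x. - sin (real n * arccos (x / 2)) / real n"
  let ?f = "\<lambda>t. 1 / sqrt (4 - t\<^sup>2) * poly (cheb_poly n) (t / 2)"
  have c: "continuous_on {-2..2} ?F" by (intro continuous_intros cont_arccos_half) (use False in auto)
  have w: "(\<lambda>t. arcsine_weight t * poly (cheb_poly n) (t / 2)) = (\<lambda>t. indicator (einterval (-2) 2) t *\<^sub>R ?f t)"
    by (simp add: fun_eq_iff arcsine_weight_eq)
  have "(LBINT t=-2..2. ?f t) = ?F 2 - ?F (-2)"
  proof (rule interval_integral_FTC_integrable)
    show "(?F has_vector_derivative ?f x) (at x)" if "-2 < ereal x" "ereal x < 2" for x
    proof -
      have x: "-2 < x" "x < 2" using that by simp_all
      have p: "poly (cheb_poly n) (x / 2) = cos (real n * arccos (x / 2))"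
        using cheb_poly_cos[of n "arccos (x / 2)"] x by (simp add: cos_arccos)
      have "((\<lambda>x. sin (real n * arccos (x / 2))) has_real_derivative
          cos (real n * arccos (x / 2)) * (real n * - (1 / sqrt (4 - x\<^sup>2)))) (at x)"
        by (intro DERIV_chain2[where f = sin] DERIV_sin DERIV_cmult deriv_arccos_half x)
      from DERIV_cdivide[OF DERIV_minus[OF this], of "real n"]
      have "(?F has_real_derivative ?f x) (at x)" unfolding p using False by (simp add: mult.commute)
      then show ?thesis by (simp add: has_real_derivative_iff_has_vector_derivative)
    qed
    show "isCont ?f x" if "-2 < ereal x" "ereal x < 2" for x
      using that by (intro continuous_mult arcsine_isCont) (auto intro!: continuous_intros)
    show "set_integrable lborel (einterval (-2) 2) ?f"
      using integrable_cheb[of 0 n] by (simp add: set_integrable_def w)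
  qed (use tendsto_real_of_ereal_ends[OF c] in auto)
  then have "(\<integral>t. arcsine_weight t * poly (cheb_poly n) (t / 2) \<partial>lborel) = 0"
    unfolding w interval_lebesgue_integral_def set_lebesgue_integral_def by simp
  then show ?thesis using False by (simp add: cheb_moment_def)
qed (simp add: cheb_moment_def arcsine_integrable)

text \<open>The factor \<open>t\<close> is \<open>2 * (t / 2)\<close>, which matches the factor 2 in
  the Chebyshev recurrence. Index 0 has no predecessor and is treated in
  \<open>cheb_moment_0_Suc\<close>.\<close>

lemma cheb_moment_Suc: "cheb_moment (Suc n) (Suc k) = cheb_moment n k + cheb_moment (Suc (Suc n)) k"
  unfolding cheb_moment_def
  by (subst Bochner_Integration.integral_add[OF integrable_cheb integrable_cheb, symmetric])
    (simp add: algebra_simps)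

lemma cheb_moment_0_Suc: "cheb_moment 0 (Suc k) = 2 * cheb_moment (Suc 0) k"
  unfolding cheb_moment_def integral_mult_right_zero[symmetric] by (simp add: mult_ac)

text \<open>On the open interval \<open>sqrt (4 - t^2)\<close> is \<open>4 - t^2\<close> times the
  arcsine weight, and \<open>4 - t^2\<close> is twice the difference of the Chebyshev polynomials of
  index 0 and 2 at \<open>t / 2\<close>.\<close>

lemma semicircle_moment: "moment semicircle k = (cheb_moment 0 k - cheb_moment 2 k) / pi"
proof -
  have *: "t ^ k * (1 / (2 * pi) * sqrt (4 - t\<^sup>2)) * indicator {-2..2} t = 
     (t ^ k * (arcsine_weight t * poly (cheb_poly 0) (t / 2)) - t ^ k * (arcsine_weight t * poly (cheb_poly 2) (t / 2))) / pi" for t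
  proof (cases "t \<in> einterval (-2) 2")
    case True
    define w where "w = 1 / sqrt (4 - t\<^sup>2)"
    have "4 - t\<^sup>2 > 0" using square_less_4 True by (simp add: einterval_2_iff)
    then have q: "sqrt (4 - t\<^sup>2) = (4 - t\<^sup>2) * w" by (simp add: w_def real_div_sqrt)
    have aw: "arcsine_weight t = w" using True by (simp add: arcsine_weight_eq w_def)
    have p: "poly (cheb_poly 2) (t / 2) = t\<^sup>2 / 2 - 1" by (simp add: numeral_2_eq_2 power2_eq_square)
    have i: "indicator {-2..2} t = (1::real)" using True by (simp add: einterval_2_iff)
    show ?thesis unfolding q aw p i by (simp add: field_simps)
  next
    case False
    then have "t \<notin> {-2..2} \<or> t = 2 \<or> t = -2" by (auto simp: einterval_2_iff)
    then show ?thesis using False by (auto simp: arcsine_weight_eq)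
  qed
  have nn: "0 \<le> indicator {-2..2} t * (1 / (2 * pi) * sqrt (4 - t\<^sup>2))" for t :: real
    using square_le_4 by (auto simp: indicator_def)
  have "moment semicircle k = (\<integral>t. t ^ k * (1 / (2 * pi) * sqrt (4 - t\<^sup>2)) * indicator {-2..2} t \<partial>lborel)"
    unfolding moment_def semicircle_def using nn by (subst integral_density) (auto simp: mult_ac)
  also have "\<dots> = (cheb_moment 0 k - cheb_moment 2 k) / pi"
    unfolding * cheb_moment_def Bochner_Integration.integral_diff[OF integrable_cheb integrable_cheb, symmetric]
    by simp
  finally show ?thesis .
qed

text \<open>Only \<open>j = 1\<close> survives in \<open>free_moments_rec\<close>; the result is the
  Catalan equation in \<open>X ^ 2\<close>.\<close>

lemma free_moments_second_fps:
  "moment_fps (free_moments second_cumulant_one) =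
     1 + fps_X ^ 2 * moment_fps (free_moments second_cumulant_one) ^ 2" (is "?C = _")
proof (rule fps_ext)
  fix k
  show "?C $ k = (1 + fps_X ^ 2 * ?C ^ 2) $ k"
  proof (cases k)
    case 0
    then show ?thesis by (simp add: moment_fps_def fps_X_power_mult_nth)
  next
    case (Suc i)
    have "?C $ k = free_moments second_cumulant_one i" by (simp add: Suc moment_fps_def)
    also have "\<dots> = (if i = 0 then 0 else ?C ^ Suc 1 $ (i - 1))"
      by (subst free_moments_rec) (rule sum_second_cumulant)
    finally show ?thesis by (simp add: Suc fps_X_power_mult_nth numeral_2_eq_2 Suc_less_eq2 del: power_Suc)
  qed
qed

text \<open>
  Up to the factor \<open>pi\<close> both sides obey \<open>E\<^sub>0 = 1 + 2 X E\<^sub>1\<close> and \<open>E\<^bsub>n+1\<^esub> = X (E\<^sub>n + E\<^bsub>n+2\<^esub>)\<close>,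
  which determines all coefficients.
\<close>

lemma cheb_moment_fps:
  fixes C :: "real fps"
  assumes C: "C = 1 + fps_X ^ 2 * C ^ 2"
  shows "Abs_fps (cheb_moment n) * (1 - 2 * fps_X ^ 2 * C) = fps_const pi * (fps_X * C) ^ n"
proof -
  define D where "D = inverse (1 - 2 * fps_X ^ 2 * C)"
  have "(1 - 2 * fps_X ^ 2 * C) $ 0 = 1" by (simp add: fps_mult_nth_0 mult.assoc)
  then have D: "D * (1 - 2 * fps_X ^ 2 * C) = 1" unfolding D_def by (intro inverse_mult_eq_1) simp
  \<comment> \<open>Closed form of the solution: the relation for \<open>E 0\<close> is the defining
    property of \<open>D\<close>, and the one for \<open>E (Suc n)\<close> is the equation for
    \<open>C\<close> multiplied by \<open>fps_X * E n\<close>.\<close>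
  define E where "E n = (fps_X * C) ^ n * D" for n
  have E0: "E 0 = 1 + fps_X * (2 * E 1)"
    using D by (simp add: E_def algebra_simps power2_eq_square)
  have ES: "E (Suc n) = fps_X * (E n + E (Suc (Suc n)))" for n
  proof -
    have "E (Suc n) = fps_X * C * E n" by (simp add: E_def mult_ac)
    also have "\<dots> = fps_X * (1 + fps_X ^ 2 * C ^ 2) * E n" by (simp only: C[symmetric])
    finally show ?thesis by (simp add: E_def algebra_simps power2_eq_square)
  qed
  have "E n $ k = cheb_moment n k / pi" for n k
  proof (induction k arbitrary: n)
    case 0
    show ?case
    proof (cases n)
      case 0 show ?thesis unfolding 0 E0 by (simp add: cheb_moment_0)
    next
      case (Suc m) show ?thesis unfolding Suc by (subst ES) (simp add: cheb_moment_0)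
    qed
  next
    case (Suc k)
    show ?case
    proof (cases n)
      case 0
      have "E 0 $ Suc k = 2 * E 1 $ k" unfolding E0 mult_2 by simp
      then show ?thesis using Suc[of 1] by (simp add: 0 cheb_moment_0_Suc)
    next
      case (Suc m)
      have "E (Suc m) $ Suc k = E m $ k + E (Suc (Suc m)) $ k" by (subst ES) simp
      then show ?thesis using Suc.IH by (simp add: Suc cheb_moment_Suc add_divide_distrib)
    qed
  qed
  then have "Abs_fps (cheb_moment n) = fps_const pi * E n" by (intro fps_ext) simp
  then show ?thesis using D by (simp add: E_def mult.assoc)
qed

text \<open>By \<open>semicircle_moment\<close> and \<open>cheb_moment_fps\<close> it suffices that
  \<open>C * ?u = 1 - (fps_X * C) ^ 2\<close>, a consequence of the equation for \<open>C\<close>;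
  the factor \<open>?u\<close> can be cancelled as its constant coefficient is 1.\<close>

lemma free_moments_semicircle: "free_moments second_cumulant_one = moment_seq semicircle"
proof -
  define C where "C = moment_fps (free_moments second_cumulant_one)"
  have C: "C = 1 + fps_X ^ 2 * C ^ 2" unfolding C_def by (rule free_moments_second_fps)
  let ?u = "1 - 2 * fps_X ^ 2 * C"
  have u: "?u \<noteq> 0"
  proof
    assume "?u = 0"
    then have "?u $ 0 = 0" by simp
    then show False by (simp add: mult.assoc)
  qed
  have X: "fps_X ^ 2 * C ^ 2 = C - 1" using C by (metis add_diff_cancel_left')
  have "C * ?u = C - 2 * (fps_X ^ 2 * C ^ 2)" by (simp add: algebra_simps power2_eq_square)
  also have "\<dots> = 1 - (fps_X * C) ^ 2" unfolding power_mult_distrib X by simp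
  finally have Cu: "C * ?u = 1 - (fps_X * C) ^ 2" .
  have "fps_const pi * C * ?u = (Abs_fps (cheb_moment 0) - Abs_fps (cheb_moment 2)) * ?u"
    unfolding mult.assoc[of "fps_const pi"] Cu left_diff_distrib[of _ _ ?u] cheb_moment_fps[OF C]
    by (simp add: right_diff_distrib)
  then have "fps_const pi * C = Abs_fps (cheb_moment 0) - Abs_fps (cheb_moment 2)" using u by simp
  then have "(fps_const pi * C) $ Suc i = cheb_moment 0 (Suc i) - cheb_moment 2 (Suc i)" for i by simp
  then have "free_moments second_cumulant_one i = moment_seq semicircle i" for i
    by (simp add: C_def moment_fps_def moment_seq_def semicircle_moment field_simps)
  then show ?thesis by blast
qed

section \<open>Linearization of the free moment recursion\<close>

definition zero_fps :: "seq \<Rightarrow> real fps" where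
  "zero_fps z = Abs_fps (with_zero z)"

text \<open>The power rule, coefficient by coefficient, by induction on the exponent through the
  Cauchy product. Coefficient \<open>k\<close> involves only entries of index below
  \<open>k\<close>, so differentiability below \<open>l\<close> suffices.\<close>

lemma moment_fps_power_deriv:
  assumes "\<And>i. i < l \<Longrightarrow> ((\<lambda>\<epsilon>. x \<epsilon> i) has_real_derivative z i) (at 0)" "k \<le> l" "x 0 = m0"
  shows "((\<lambda>\<epsilon>. moment_fps (x \<epsilon>) ^ j $ k) has_real_derivative
    (of_nat j * moment_fps m0 ^ (j - 1) * zero_fps z) $ k) (at 0)"
  using assms(2)
proof (induction j arbitrary: k)
  case (Suc j)
  let ?F = "\<lambda>\<epsilon>. moment_fps (x \<epsilon>)"
  let ?D = "\<lambda>j. of_nat j * moment_fps m0 ^ (j - 1) * zero_fps z"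
  have "((\<lambda>\<epsilon>. \<Sum>i=0..k. ?F \<epsilon> $ i * ?F \<epsilon> ^ j $ (k - i)) has_real_derivative
      (\<Sum>i=0..k. zero_fps z $ i * moment_fps m0 ^ j $ (k - i) + moment_fps m0 $ i * ?D j $ (k - i))) (at 0)"
  proof (rule DERIV_sum)
    fix i assume i: "i \<in> {0..k}"
    have "((\<lambda>\<epsilon>. ?F \<epsilon> $ i) has_real_derivative zero_fps z $ i) (at 0)"
      using with_unit_deriv[of l x z i] assms(1) i Suc.prems by (simp add: moment_fps_def zero_fps_def)
    from DERIV_mult[OF this, of "\<lambda>\<epsilon>. ?F \<epsilon> ^ j $ (k - i)" "?D j $ (k - i)"] Suc.IH[of "k - i"] Suc.prems
    show "((\<lambda>\<epsilon>. ?F \<epsilon> $ i * ?F \<epsilon> ^ j $ (k - i)) has_real_derivative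
        zero_fps z $ i * moment_fps m0 ^ j $ (k - i) + moment_fps m0 $ i * ?D j $ (k - i)) (at 0)"
      by (simp add: assms(3) mult.commute)
  qed
  moreover have "(\<Sum>i=0..k. zero_fps z $ i * moment_fps m0 ^ j $ (k - i) + moment_fps m0 $ i * ?D j $ (k - i)) = ?D (Suc j) $ k"
  proof -
    have "?D (Suc j) = zero_fps z * moment_fps m0 ^ j + moment_fps m0 * ?D j"
      by (cases j) (simp_all add: algebra_simps)
    then show ?thesis by (simp only: sum.distrib fps_add_nth fps_mult_nth[of "zero_fps z"] fps_mult_nth[of "moment_fps m0"])
  qed
  ultimately show ?case by (simp only: power_Suc fps_mult_nth)
qed simp

lemma zero_fps_sum: "zero_fps (\<lambda>i. \<Sum>n\<in>N. s n * Y n i) = (\<Sum>n\<in>N. fps_const (s n) * zero_fps (Y n))"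
  by (rule fps_ext) (simp add: zero_fps_def with_zero_sum fps_sum_nth)

lemma zero_fps_mult_cong:
  assumes "\<And>i. i < l \<Longrightarrow> y i = z i" "k \<le> l"
  shows "(A * zero_fps y) $ k = (A * zero_fps z) $ k"
  unfolding fps_mult_nth zero_fps_def using assms(2)
  by (intro sum.cong refl) (simp add: with_zero_cong[of l y z, OF assms(1)])

text \<open>The constant coefficients agree because the Chebyshev densities of positive index have
  total mass 0.\<close>

lemma zero_fps_cheb_moment: "zero_fps (\<lambda>k. cheb_moment (Suc n) (Suc k) / pi) = fps_const (1 / pi) * Abs_fps (cheb_moment (Suc n))"
proof (rule fps_ext)
  fix k show "zero_fps (\<lambda>k. cheb_moment (Suc n) (Suc k) / pi) $ k = (fps_const (1 / pi) * Abs_fps (cheb_moment (Suc n))) $ k"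
    by (cases k) (simp_all add: zero_fps_def cheb_moment_0)
qed

text \<open>Orthogonality of Chebyshev polynomials to lower degrees, by iterating
  \<open>cheb_moment_Suc\<close> down to order 0.\<close>

lemma cheb_moment_lower: "k < n \<Longrightarrow> cheb_moment n k = 0"
proof (induction k arbitrary: n)
  case (Suc k)
  then show ?case by (cases n) (simp_all add: cheb_moment_Suc)
qed (simp add: cheb_moment_0)

text \<open>Coefficient \<open>Suc k\<close> of
  \<open>V = (X * C) ^ Suc n + 2 * X ^ 2 * C * V\<close>, which is \<open>cheb_moment_fps\<close>
  rearranged. The two summands are the direct term and the linearized \<open>j = 1\<close> term of
  \<open>v_rec\<close>.\<close>

lemma cheb_moment_expand:
  "cheb_moment (Suc n) (Suc k) / pi = (if n \<le> k then moment_fps (moment_seq semicircle) ^ Suc n $ (k - n) else 0) +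
    (if k = 0 then 0 else (2 * moment_fps (moment_seq semicircle) * zero_fps (\<lambda>k. cheb_moment (Suc n) (Suc k) / pi)) $ (k - 1))"
proof -
  define C where "C = moment_fps (moment_seq semicircle)"
  define V where "V = fps_const (1 / pi) * Abs_fps (cheb_moment (Suc n))"
  have C: "C = 1 + fps_X ^ 2 * C ^ 2"
    unfolding C_def free_moments_semicircle[symmetric] by (rule free_moments_second_fps)
  have "V * (1 - 2 * fps_X ^ 2 * C) = fps_const (1 / pi) * fps_const pi * (fps_X * C) ^ Suc n"
    unfolding V_def mult.assoc using cheb_moment_fps[OF C, of "Suc n"] by (simp only: mult.assoc)
  then have "V = fps_X ^ Suc n * C ^ Suc n + fps_X ^ 2 * (2 * C * V)"
    by (simp add: algebra_simps power_mult_distrib)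
  then have "V $ Suc k = (fps_X ^ Suc n * C ^ Suc n + fps_X ^ 2 * (2 * C * V)) $ Suc k" by metis
  also have "\<dots> = (if n \<le> k then C ^ Suc n $ (k - n) else 0) + (if k = 0 then 0 else (2 * C * V) $ (k - 1))"
    by (auto simp: fps_X_power_mult_nth simp del: power_Suc)
  finally show ?thesis by (simp add: V_def C_def zero_fps_cheb_moment)
qed

text \<open>The diagonal weight is 1 because moment series have constant coefficient 1; dividing by
  \<open>pi\<close> normalises the Chebyshev moments to \<open>v n n = 1\<close>.\<close>

interpretation free: triangular_moments free_moments
  "\<lambda>k j m. moment_fps m ^ Suc j $ (k - j)"
  "\<lambda>k j z. (of_nat (Suc j) * moment_fps (moment_seq semicircle) ^ j * zero_fps z) $ (k - j)"
  "\<lambda>_. 1" second_cumulant_one "moment_seq semicircle"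
  "\<lambda>n k. cheb_moment (Suc n) (Suc k) / pi"
proof
  fix k j :: nat
  show "free_moments c k = (\<Sum>j\<le>k. c j * (moment_fps (free_moments c) ^ Suc j $ (k - j)))" for c
    by (rule free_moments_rec)
  show "((\<lambda>\<epsilon>. moment_fps (x \<epsilon>) ^ Suc j $ (k - j)) has_real_derivative
      (of_nat (Suc j) * moment_fps (moment_seq semicircle) ^ j * zero_fps z) $ (k - j)) (at 0)"
    if "x 0 = moment_seq semicircle" "\<And>i. i < k \<Longrightarrow> ((\<lambda>\<epsilon>. x \<epsilon> i) has_real_derivative z i) (at 0)" for x z
    using moment_fps_power_deriv[of k x z "k - j" _ "Suc j", OF that(2) _ that(1)] by simp
  show "(of_nat (Suc j) * moment_fps (moment_seq semicircle) ^ j * zero_fps (\<lambda>i. \<Sum>n\<in>N. s n * Y n i)) $ (k - j) =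
      (\<Sum>n\<in>N. s n * (of_nat (Suc j) * moment_fps (moment_seq semicircle) ^ j * zero_fps (Y n)) $ (k - j))"
    for N :: "nat set" and s Y
    by (simp only: zero_fps_sum sum_distrib_left fps_sum_nth mult.left_commute[of _ "fps_const _"] fps_mult_left_const_nth)
  show "(of_nat (Suc j) * moment_fps (moment_seq semicircle) ^ j * zero_fps y) $ (k - j) =
      (of_nat (Suc j) * moment_fps (moment_seq semicircle) ^ j * zero_fps z) $ (k - j)"
    if "\<And>i. i < k \<Longrightarrow> y i = z i" for y z
    by (rule zero_fps_mult_cong[of k]) (use that in auto)
  show "cheb_moment (Suc n) (Suc k) / pi = 0" if "k < n" for n
    using that by (simp add: cheb_moment_lower)
  show "cheb_moment (Suc n) (Suc k) / pi = moment_fps (moment_seq semicircle) ^ Suc n $ (k - n) +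
      (\<Sum>j\<le>k. second_cumulant_one j * (of_nat (Suc j) * moment_fps (moment_seq semicircle) ^ j *
          zero_fps (\<lambda>k. cheb_moment (Suc n) (Suc k) / pi)) $ (k - j))" if "n \<le> k" for n
    unfolding sum_second_cumulant using cheb_moment_expand[of n k] that by simp
  show "moment_fps m ^ Suc k $ (k - k) = 1" for m
    by (simp add: moment_fps_def fps_power_zeroth_eq_one)
qed (auto simp: bij_free_moments free_moments_semicircle cumulant_scaling_second)

section \<open>The spectrum in the free case\<close>

lemma free_spectrum:
  defines "L \<equiv> gateaux_derivative free_clt (moment_seq semicircle)"
  shows "(\<forall>y. has_gateaux_derivative free_clt (moment_seq semicircle) y (L y)) \<and>
    {l. \<exists>y. eigenvector L l y} = {2 powr (1 - real n / 2) |n. n \<ge> 1} \<and>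
    (\<forall>n\<ge>1. eigenfunctions_have_density L (2 powr (1 - real n / 2))
      (\<lambda>t. indicator {-2..2} t * (1 / sqrt (4 - t\<^sup>2)) * poly (cheb_poly n) (t / 2)))"
  unfolding L_def free_clt_def free_cumulants_def arcsine_weight_def[symmetric]
proof (rule free.clt_spectrum[where \<kappa> = "\<lambda>n. pi"])
  fix n k :: nat
  have "(\<lambda>t. poly (cheb_poly n) (t / 2)) \<in> borel_measurable borel"
    by (intro borel_measurable_continuous_onI continuous_intros) simp
  then show "(\<lambda>t. arcsine_weight t * poly (cheb_poly n) (t / 2)) \<in> borel_measurable borel"
    by measurable
  show "integrable lborel (\<lambda>t. t ^ k * (arcsine_weight t * poly (cheb_poly n) (t / 2)))"
    by (rule integrable_cheb)
  show "(\<integral>t. arcsine_weight t * poly (cheb_poly n) (t / 2) \<partial>lborel) = 0" if "1 \<le> n"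
    using that cheb_moment_0[of n] by (simp add: cheb_moment_def)
  show "(\<integral>t. t ^ Suc k * (arcsine_weight t * poly (cheb_poly (Suc n)) (t / 2)) \<partial>lborel) =
      pi * (cheb_moment (Suc n) (Suc k) / pi)"
    by (simp add: cheb_moment_def)
qed simp

theorem theorem2p4:
  shows "(let L = gateaux_derivative classical_clt (moment_seq gaussian) in
            (\<forall>y. has_gateaux_derivative classical_clt (moment_seq gaussian) y (L y)) \<and>
            {l. \<exists>y. eigenvector L l y} = {2 powr (1 - real n / 2) |n. n \<ge> 1} \<and>
            (\<forall>n\<ge>1.
               eigenfunctions_have_density L (2 powr (1 - real n / 2))
                 ((deriv ^^ n) (\<lambda>x. exp (- x\<^sup>2 / 2))) \<and>
               (\<forall>x. (deriv ^^ n) (\<lambda>u. exp (- u\<^sup>2 / 2)) x = exp (- x\<^sup>2 / 2) * hermite_fun n x) \<and>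
               (\<exists>c. c \<noteq> 0 \<and> (\<forall>x. hermite_fun n x = c * poly (hermite_poly n) x))))
       \<and> (let L = gateaux_derivative free_clt (moment_seq semicircle) in
            (\<forall>y. has_gateaux_derivative free_clt (moment_seq semicircle) y (L y)) \<and>
            {l. \<exists>y. eigenvector L l y} = {2 powr (1 - real n / 2) |n. n \<ge> 1} \<and>
            (\<forall>n\<ge>1.
               eigenfunctions_have_density L (2 powr (1 - real n / 2))
                 (\<lambda>t. indicator {-2..2} t * (1 / sqrt (4 - t\<^sup>2)) * poly (cheb_poly n) (t / 2))))"
proof -
  have exp: "exp (- x\<^sup>2 / 2) * exp (x\<^sup>2 / 2) = 1" for x :: real
    by (simp flip: exp_add)
  have "(deriv ^^ n) (\<lambda>u. exp (- u\<^sup>2 / 2)) x = exp (- x\<^sup>2 / 2) * hermite_fun n x" for n x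
    unfolding hermite_fun_def mult.assoc[symmetric] exp by simp
  moreover have "hermite_fun n x = (-1) ^ n * poly (hermite_poly n) x" for n x
    unfolding hermite_fun_def deriv_gauss using exp[of x] by (simp only: mult_ac)
  then have "\<exists>c. c \<noteq> 0 \<and> (\<forall>x. hermite_fun n x = c * poly (hermite_poly n) x)" for n
    by (intro exI[of _ "(-1) ^ n"]) simp
  ultimately show ?thesis
    unfolding Let_def using classical_spectrum free_spectrum by blast
qed

end
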